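(* Let $\phi$ and $\psi$ be bounded radial functions on $\mathbb{D}$ and let $p$ be an integer. If $T_{e^{ip\theta}\phi}$ commutes with $T_{e^{ip\theta}\psi}$ on $L^2_h$, then $\phi=c\psi$, where $c$ is a constant.
   Context: $\mathbb{D}$ is the unit disk of the complex plane and $dA=r\,dr\,\frac{d\theta}{\pi}$ is normalized Lebesgue measure on $\mathbb{D}$. The harmonic Bergman space $L^2_h$ is the closed subspace of $L^2(\mathbb{D},dA)$ consisting of all harmonic functions on $\mathbb{D}$, and $Q$ is the orthogonal projection of $L^2(\mathbb{D},dA)$ onto $L^2_h$. For a bounded function $f$ on $\mathbb{D}$, the Toeplitz operator $T_f$ on $L^2_h$ with symbol $f$ is defined by $T_f(u)=Q(fu)$ for $u\in L^2_h$. A function $\phi$ on $\mathbb{D}$ is radial if $\phi(z)$ depends only on $r=|z|$; $e^{ip\theta}\phi$ denotes the function $re^{i\theta}\mapsto e^{ip\theta}\phi(r)$.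
   Formalization: Adds p ≠ 0 (for p = 0 any two bounded radial symbols give commuting operators, e.g. φ = r, ψ = 1) and that ψ is not almost everywhere zero (ψ = 0 commutes with every φ); φ = cψ is meant almost everywhere, for measurable symbols. *)

theory Defs
  imports "HOL-Analysis.Analysis"
begin

abbreviation unit_disk :: "complex set" where
  "unit_disk \<equiv> ball 0 1"

text \<open>Normalized area measure on the disk; in polar coordinates it is r dr d\<theta> / \<pi>.\<close>

definition disk_measure :: "complex measure" where
  "disk_measure = scale_measure (ennreal (1 / pi)) (lebesgue_on unit_disk)"

definition L2 :: "'a measure \<Rightarrow> ('a \<Rightarrow> complex) set" where
  "L2 M = {f \<in> borel_measurable M. integrable M (\<lambda>x. (cmod (f x))\<^sup>2)}"

definition L2_inner :: "'a measure \<Rightarrow> ('a \<Rightarrow> complex) \<Rightarrow> ('a \<Rightarrow> complex) \<Rightarrow> complex" where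
  "L2_inner M f g = (LINT x|M. f x * cnj (g x))"

definition partial_x :: "(complex \<Rightarrow> complex) \<Rightarrow> complex \<Rightarrow> complex" where
  "partial_x u z = vector_derivative (\<lambda>t::real. u (z + of_real t)) (at 0)"

definition partial_y :: "(complex \<Rightarrow> complex) \<Rightarrow> complex \<Rightarrow> complex" where
  "partial_y u z = vector_derivative (\<lambda>t::real. u (z + \<i> * of_real t)) (at 0)"

text \<open>Twice continuously differentiable in the real sense. Note that
  \<open>differentiable_on\<close> is real (Frechet) differentiability, not complex
  differentiability. It guarantees that all the partial derivatives involved exist.\<close>

definition C2_on :: "complex set \<Rightarrow> (complex \<Rightarrow> complex) \<Rightarrow> bool" where
  "C2_on S u \<longleftrightarrow>
     u differentiable_on S \<and>
     (\<forall>v \<in> {partial_x u, partial_y u}.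
        v differentiable_on S \<and>
        continuous_on S (partial_x v) \<and> continuous_on S (partial_y v))"

definition harmonic_on :: "complex set \<Rightarrow> (complex \<Rightarrow> complex) \<Rightarrow> bool" where
  "harmonic_on S u \<longleftrightarrow>
     C2_on S u \<and>
     (\<forall>z\<in>S. partial_x (partial_x u) z + partial_y (partial_y u) z = 0)"

text \<open>The harmonic Bergman space. An element is represented by its harmonic
  representative, normalized to vanish outside the disk, so that two elements that
  agree almost everywhere on the disk are equal.\<close>

definition harmonic_Bergman :: "(complex \<Rightarrow> complex) set" where
  "harmonic_Bergman =
     {u \<in> L2 disk_measure. harmonic_on unit_disk u \<and> (\<forall>z. z \<notin> unit_disk \<longrightarrow> u z = 0)}"

text \<open>Orthogonal projection onto the harmonic Bergman space: the unique element \<open>h\<close> of the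
  space with \<open>f - h\<close> orthogonal to the space. It exists for \<open>f\<close> in \<open>L2 disk_measure\<close> because
  the space is closed; the value is meaningless for other \<open>f\<close>.\<close>

definition harmonic_proj :: "(complex \<Rightarrow> complex) \<Rightarrow> complex \<Rightarrow> complex" where
  "harmonic_proj f =
     (THE h. h \<in> harmonic_Bergman \<and>
        (\<forall>u\<in>harmonic_Bergman. L2_inner disk_measure (\<lambda>z. f z - h z) u = 0))"

definition Toeplitz :: "(complex \<Rightarrow> complex) \<Rightarrow> (complex \<Rightarrow> complex) \<Rightarrow> complex \<Rightarrow> complex" where
  "Toeplitz f u = harmonic_proj (\<lambda>z. f z * u z)"

definition radial :: "(complex \<Rightarrow> complex) \<Rightarrow> bool" where
  "radial \<phi> \<longleftrightarrow> (\<forall>z\<in>unit_disk. \<forall>w\<in>unit_disk. cmod z = cmod w \<longrightarrow> \<phi> z = \<phi> w)"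

text \<open>The function sending \<open>r * cis \<theta>\<close> to \<open>cis (p * \<theta>) * \<phi> r\<close>. Since \<open>p\<close> is an integer, the
  branch of the argument does not matter.\<close>

definition quasihomogeneous :: "int \<Rightarrow> (complex \<Rightarrow> complex) \<Rightarrow> complex \<Rightarrow> complex" where
  "quasihomogeneous p \<phi> z = cis (of_int p * Arg z) * \<phi> (of_real (cmod z))"

end

theory Submission
  imports Defs "HOL-Complex_Analysis.Complex_Analysis"
begin

unbundle no fps_syntax

text \<open>
  Write \<open>e\<^sub>k\<close> for \<open>z\<^sup>k\<close> (\<open>k \<ge> 0\<close>) or the \<open>-k\<close>-th power of the conjugate of \<open>z\<close> (\<open>k < 0\<close>). A harmonic
  function is the sum of a holomorphic and an antiholomorphic function, so its part of angular
  frequency \<open>k\<close> is a multiple of \<open>e\<^sub>k\<close>; hence the Toeplitz operator with symbol \<open>e\<^sup>i\<^sup>p\<^sup>\<theta> \<phi>\<close> maps \<open>e\<^sub>n\<close> to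
  a multiple of \<open>e\<^bsub>n+p\<^esub>\<close> whose coefficient is, up to a factor independent of \<open>\<phi>\<close>, the Mellin transform
  \<open>A(s) = \<integral> \<phi> \<bar>z\<bar>\<^sup>s dA\<close> at \<open>s = \<bar>n\<bar> + \<bar>n + p\<bar>\<close>. With \<open>q = \<bar>p\<bar>\<close> and \<open>B\<close> the transform of \<open>\<psi>\<close>, commutation gives
  \<open>A(s) B(s + 2q) = A(s + 2q) B(s)\<close> for \<open>s = q + 2m\<close>, \<open>m \<ge> 0\<close>. Both sides are bounded and holomorphic on
  the right half-plane, and the zeros \<open>q + 2m\<close> of their difference violate the Blaschke condition, so
  the identity holds for all \<open>s > 0\<close>. Choosing \<open>s\<^sub>0 > 0\<close> such that \<open>B\<close> has no zero in \<open>s\<^sub>0 + 2q\<nat>\<close>, the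
  quotient \<open>A/B\<close> has a constant value \<open>c\<close> on this progression, so \<open>A - c B\<close> vanishes there and, by
  the Blaschke argument again, on all positive reals. Then all moments of \<open>\<phi> - c \<psi>\<close> vanish, and
  \<open>\<phi> = c \<psi>\<close> almost everywhere.
\<close>

subsection \<open>Rotation invariance of the area measure\<close>

text \<open>The two measures agree on boxes, because the preimage of a box is a box with the same
  side lengths. This identification carries the invariance of Lebesgue measure under orthogonal maps
  of \<open>real^2\<close> over to the complex plane.\<close>

lemma distr_lborel_Complex:
  "distr (lborel :: (real^2) measure) borel (\<lambda>v. Complex (v$1) (v$2)) = lborel"
proof (rule lborel_eqI[symmetric])
  have m [measurable]: "(\<lambda>v::real^2. Complex (v$1) (v$2)) \<in> borel_measurable borel"
    by (intro borel_measurable_continuous_onI) (auto simp: Complex_eq intro!: continuous_intros)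
  fix l u :: complex assume le: "\<And>b. b \<in> Basis \<Longrightarrow> l \<bullet> b \<le> u \<bullet> b"
  have "(\<lambda>v::real^2. Complex (v$1) (v$2)) -` box l u = box (vector [Re l, Im l]) (vector [Re u, Im u])"
    by (auto simp: box_def Basis_complex_def Basis_vec_def UNIV_2 inner_axis)
  moreover have "prod f (Basis :: (real^2) set) = f (axis 1 1) * f (axis 2 1)" for f :: "real^2 \<Rightarrow> real"
  proof -
    have "(Basis :: (real^2) set) = {axis 1 1, axis 2 1}"
      by (auto simp: Basis_vec_def UNIV_2)
    moreover have "axis 1 1 \<noteq> (axis 2 1 :: real^2)"
      by (simp add: axis_eq_axis)
    ultimately show ?thesis by (metis (no_types, lifting) prod.insert finite.intros empty_iff insert_iff prod.empty mult_1_right)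
  qed
  ultimately show "emeasure (distr lborel borel (\<lambda>v::real^2. Complex (v$1) (v$2))) (box l u)
      = ennreal (\<Prod>b\<in>Basis. (u - l) \<bullet> b)"
    using le[of 1] le[of \<i>]
    by (auto simp: emeasure_distr emeasure_lborel_box_eq Basis_complex_def inner_axis Basis_vec_def UNIV_2)
qed simp

text \<open>It suffices to compare boxes. Read in real coordinates, the preimage of a box under
  multiplication by \<open>w\<close> is the image of a box under an orthogonal map, which preserves
  its measure.\<close>

lemma distr_lborel_rotate:
  assumes w: "cmod w = 1"
  shows "distr lborel borel ((*) w) = lborel"
proof (rule lborel_eqI[symmetric])
  define T where "T = (\<lambda>v::real^2. Complex (v$1) (v$2))"
  \<comment> \<open>\<open>g\<close> is multiplication by \<open>cnj w\<close>, the inverse of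
    \<open>w\<close>, in real coordinates; preimages under \<open>w\<close> thus become images under
    \<open>g\<close>.\<close>
  define g :: "real^2 \<Rightarrow> real^2" where "g = (\<lambda>v. vector [Re (cnj w * T v), Im (cnj w * T v)])"
  have m [measurable]: "T \<in> borel_measurable borel" "((*) w) \<in> borel_measurable borel"
    by (auto intro!: borel_measurable_continuous_onI continuous_intros simp: T_def Complex_eq)
  fix l u :: complex assume le: "\<And>b. b \<in> Basis \<Longrightarrow> l \<bullet> b \<le> u \<bullet> b"
  have Tg: "T (g v) = cnj w * T v" for v
    by (simp add: T_def g_def complex_eq_iff)
  have wc: "w * cnj w = 1"
    using w by (simp add: complex_norm_square[symmetric])
  have gl: "orthogonal_transformation g"
    unfolding orthogonal_transformation
  proof
    show "linear g"
      by (rule linearI) (auto simp: g_def T_def vec_eq_iff forall_2 algebra_simps)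
    have nT: "norm v = cmod (T v)" for v :: "real^2"
      by (simp add: T_def cmod_def norm_vec_def L2_set_def UNIV_2)
    show "\<forall>v. norm (g v) = norm v"
      unfolding nT Tg using w by (simp add: norm_mult)
  qed
  have Ti: "T v = T v' \<Longrightarrow> v = v'" for v v'
    by (simp add: T_def vec_eq_iff forall_2)
  have eq: "T -` ((*) w -` box l u) = g ` (T -` box l u)"
  proof (intro equalityI subsetI)
    fix v assume "v \<in> T -` ((*) w -` box l u)"
    hence "w * T v \<in> box l u" by simp
    define v' :: "real^2" where "v' = vector [Re (w * T v), Im (w * T v)]"
    have v': "T v' = w * T v" by (simp add: T_def v'_def complex_eq_iff)
    hence "T (g v') = T v" using wc by (simp add: Tg mult.assoc[symmetric] mult.commute)
    hence "v = g v'" by (simp add: Ti)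
    moreover have "v' \<in> T -` box l u" using v' \<open>w * T v \<in> box l u\<close> by simp
    ultimately show "v \<in> g ` (T -` box l u)" by blast
  next
    fix v' assume "v' \<in> g ` (T -` box l u)"
    then obtain v where "v' = g v" "T v \<in> box l u" by auto
    thus "v' \<in> T -` ((*) w -` box l u)" using wc by (simp add: Tg mult.assoc[symmetric])
  qed
  have bx: "T -` box l u = box (vector [Re l, Im l]) (vector [Re u, Im u])"
    by (auto simp: T_def box_def Basis_complex_def Basis_vec_def UNIV_2 inner_axis)
  have lm: "T -` box l u \<in> lmeasurable" unfolding bx by simp
  have "emeasure (distr lborel borel ((*) w)) (box l u) = emeasure lborel ((*) w -` box l u)"
    by (simp add: emeasure_distr)
  also have "\<dots> = emeasure (distr lborel borel T) ((*) w -` box l u)"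
    unfolding T_def distr_lborel_Complex ..
  also have "\<dots> = emeasure lborel (T -` ((*) w -` box l u))"
    using measurable_sets[OF m(2), of "box l u"] by (subst emeasure_distr) auto
  also have "\<dots> = emeasure lebesgue (T -` ((*) w -` box l u))"
    using measurable_sets[OF m(1) measurable_sets[OF m(2), of "box l u", simplified]]
    by (simp add: emeasure_completion main_part_sets)
  also have "\<dots> = ennreal (measure lebesgue (g ` (T -` box l u)))"
    unfolding eq by (rule emeasure_eq_measure2[OF measurable_orthogonal_image[OF gl lm]])
  also have "\<dots> = ennreal (measure lebesgue (T -` box l u))"
    using measure_orthogonal_image[OF gl lm] by simp
  also have "\<dots> = emeasure lebesgue (T -` box l u)"
    by (rule emeasure_eq_measure2[OF lm, symmetric])
  also have "\<dots> = emeasure lborel (T -` box l u)"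
    unfolding bx by simp
  also have "\<dots> = emeasure (distr lborel borel T) (box l u)"
    by (subst emeasure_distr) auto
  also have "\<dots> = emeasure lborel (box l u)"
    unfolding T_def distr_lborel_Complex ..
  finally show "emeasure (distr lborel borel ((*) w)) (box l u) = ennreal (\<Prod>b\<in>Basis. (u - l) \<bullet> b)"
    using le by (simp add: emeasure_lborel_box)
qed simp

text \<open>The Borel statement passes to the completion, on whose sets \<open>disk_measure\<close>
  is built.\<close>

lemma distr_lebesgue_rotate:
  fixes w :: complex
  assumes w: "cmod w = 1"
  shows "((*) w) \<in> lebesgue \<rightarrow>\<^sub>M lebesgue" "distr lebesgue lebesgue ((*) w) = lebesgue"
proof -
  have [measurable]: "((*) w) \<in> borel_measurable borel" by simp
  have d: "distr lebesgue lborel ((*) w) = lborel"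
    using distr_lborel_rotate[OF w] by (simp add: distr_completion cong: distr_cong)
  show "((*) w) \<in> lebesgue \<rightarrow>\<^sub>M lebesgue"
    by (simp add: completion.measurable_completion2 d measurable_completion)
  have "completion (distr lebesgue lborel ((*) w)) = distr lebesgue lebesgue ((*) w)"
    by (subst completion.completion_distr_eq) (auto simp: d measurable_completion)
  thus "distr lebesgue lebesgue ((*) w) = lebesgue"
    by (simp add: d)
qed

section \<open>Measurable sets, null sets and rotations for the normalized area measure\<close>

lemma space_disk_measure [simp]: "space disk_measure = unit_disk"
  by (simp add: disk_measure_def space_scale_measure)

lemma sets_disk_measure [measurable_cong]: "sets disk_measure = sets (lebesgue_on unit_disk)"
  by (simp add: disk_measure_def)

lemma sets_disk_measure_iff: "A \<in> sets disk_measure \<longleftrightarrow> A \<in> sets lebesgue \<and> A \<subseteq> unit_disk"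
  by (auto simp: sets_disk_measure sets_restrict_space_iff)

lemma emeasure_disk_measure:
  "A \<in> sets disk_measure \<Longrightarrow> emeasure disk_measure A = ennreal (1 / pi) * emeasure lebesgue A"
  using emeasure_restrict_space[of unit_disk lebesgue A]
  by (simp only: disk_measure_def emeasure_scale_measure sets_disk_measure_iff[unfolded disk_measure_def]) simp

lemma finite_measure_disk_measure: "finite_measure disk_measure"
proof
  have "ball 0 1 \<in> sets disk_measure"
    by (simp add: sets_disk_measure_iff)
  moreover have "emeasure lebesgue (ball 0 1 :: complex set) \<noteq> \<infinity>"
    using lmeasurable_ball[of "0 :: complex" 1] unfolding fmeasurable_def by auto
  ultimately show "emeasure disk_measure (space disk_measure) \<noteq> \<infinity>"
    by (simp only: space_disk_measure emeasure_disk_measure) (simp only: infinity_ennreal_def ennreal_mult_eq_top_iff, simp)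
qed

interpretation disk_measure: finite_measure disk_measure
  by (rule finite_measure_disk_measure)

lemma measurable_disk_measure_eq: "borel_measurable disk_measure = borel_measurable (lebesgue_on unit_disk)"
  by (rule measurable_cong_sets[OF sets_disk_measure refl])

lemma null_sets_disk_measure: "N \<in> null_sets disk_measure \<longleftrightarrow> N \<in> null_sets lebesgue \<and> N \<subseteq> unit_disk"
proof (cases "N \<in> sets disk_measure")
  case True
  thus ?thesis
    using sets_disk_measure_iff[of N] emeasure_disk_measure[OF True] by (simp only: null_sets_def mem_Collect_eq) simp
next
  case False
  thus ?thesis using sets_disk_measure_iff[of N] by (auto simp only: null_sets_def)
qed

lemma AE_disk_measure_nonzero: "AE z in disk_measure. z \<noteq> 0"
proof -
  have "{0::complex} \<in> null_sets disk_measure"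
    using negligible_sing[of "0::complex"] by (simp add: null_sets_disk_measure negligible_iff_null_sets)
  thus ?thesis by (rule AE_I') auto
qed

lemma rotate_disk_measure:
  assumes w: "cmod w = 1"
  shows "((*) w) \<in> disk_measure \<rightarrow>\<^sub>M disk_measure"
    and "distr disk_measure disk_measure ((*) w) = disk_measure"
proof -
  have v: "(*) w -` A \<in> sets lebesgue" "emeasure lebesgue ((*) w -` A) = emeasure lebesgue A"
    if "A \<in> sets lebesgue" for A
  proof -
    show "(*) w -` A \<in> sets lebesgue"
      using measurable_sets[OF distr_lebesgue_rotate(1)[OF w] that] by simp
    show "emeasure lebesgue ((*) w -` A) = emeasure lebesgue A"
      using emeasure_distr[OF distr_lebesgue_rotate(1)[OF w] that]
      unfolding distr_lebesgue_rotate(2)[OF w] by simp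
  qed
  have u: "(*) w -` A \<subseteq> unit_disk" if "A \<subseteq> unit_disk" for A
    using that w by (fastforce simp: norm_mult)
  show m: "((*) w) \<in> disk_measure \<rightarrow>\<^sub>M disk_measure"
  proof (rule measurableI)
    fix A assume A: "A \<in> sets disk_measure"
    hence "(*) w -` A \<inter> unit_disk = (*) w -` A"
      using u[of A] by (auto simp: sets_disk_measure_iff)
    thus "(*) w -` A \<inter> space disk_measure \<in> sets disk_measure"
      using A u[of A] v[of A] by (simp add: sets_disk_measure_iff)
  qed (use w in \<open>auto simp: norm_mult\<close>)
  show "distr disk_measure disk_measure ((*) w) = disk_measure"
  proof (rule measure_eqI)
    fix A assume "A \<in> sets (distr disk_measure disk_measure ((*) w))"
    hence A: "A \<in> sets disk_measure" by simp
    hence "(*) w -` A \<inter> unit_disk = (*) w -` A" "(*) w -` A \<in> sets disk_measure"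
      using u[of A] v[of A] by (auto simp: sets_disk_measure_iff)
    thus "emeasure (distr disk_measure disk_measure ((*) w)) A = emeasure disk_measure A"
      using emeasure_distr[OF m A] v(2)[of A] A by (simp only: space_disk_measure emeasure_disk_measure sets_disk_measure_iff)
  qed simp
qed

lemma integral_disk_rotate:
  fixes f :: "complex \<Rightarrow> complex"
  assumes "cmod w = 1" "f \<in> borel_measurable disk_measure"
  shows "(LINT z|disk_measure. f (w * z)) = (LINT z|disk_measure. f z)"
  using integral_distr[OF rotate_disk_measure(1)[OF assms(1)] assms(2)]
  by (simp add: rotate_disk_measure(2)[OF assms(1)])

text \<open>Rotating the variable by \<open>w\<close> leaves the integral unchanged and also
  multiplies it by \<open>w powi k\<close>, so it vanishes once that power differs from 1. The
  origin, a null set, is exempt because symbols of nonzero frequency may violate the equation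
  there.\<close>

lemma integral_disk_weight_eq_0:
  fixes f :: "complex \<Rightarrow> complex"
  assumes f: "f \<in> borel_measurable disk_measure" and k: "k \<noteq> 0"
    and eq: "\<And>w z. cmod w = 1 \<Longrightarrow> z \<in> unit_disk \<Longrightarrow> z \<noteq> 0 \<Longrightarrow> f (w * z) = w powi k * f z"
  shows "(LINT z|disk_measure. f z) = 0"
proof -
  \<comment> \<open>With this \<open>w\<close> the power \<open>w powi k\<close> is
    \<open>cis 1\<close> for every nonzero \<open>k\<close>, and \<open>cis 1\<close> is not 1
    because its imaginary part is positive.\<close>
  define w where "w = cis (1 / of_int k)"
  have w: "cmod w = 1" by (simp add: w_def)
  have "w powi k = cis 1"
    using k by (simp add: w_def cis_power_int)
  moreover have "cis 1 \<noteq> 1"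
    using sin_gt_zero[of 1] pi_gt3 by (auto simp: complex_eq_iff)
  ultimately have wk: "w powi k \<noteq> 1" by simp
  have "(LINT z|disk_measure. f z) = (LINT z|disk_measure. f (w * z))"
    using integral_disk_rotate[OF w f] by simp
  also have "\<dots> = (LINT z|disk_measure. w powi k * f z)"
  proof (rule integral_cong_AE)
    show "(\<lambda>z. f (w * z)) \<in> borel_measurable disk_measure"
      using measurable_compose[OF rotate_disk_measure(1)[OF w] f] .
    show "AE z in disk_measure. f (w * z) = w powi k * f z"
      using AE_disk_measure_nonzero AE_space by eventually_elim (simp add: eq[OF w])
  qed (use f in simp)
  also have "\<dots> = w powi k * (LINT z|disk_measure. f z)" by simp
  finally show ?thesis using wk by (simp add: algebra_simps)
qed

subsection \<open>Harmonic functions as sums of holomorphic and antiholomorphic functions\<close>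

lemma has_derivative_partials:
  assumes "(u has_derivative D) (at z)"
  shows "partial_x u z = D 1" "partial_y u z = D \<i>"
proof -
  have "((\<lambda>t::real. u (z + a * of_real t)) has_vector_derivative D a) (at 0)" for a
  proof -
    have 1: "((\<lambda>t::real. z + a * of_real t) has_vector_derivative a) (at 0)"
      by (auto intro!: derivative_eq_intros simp: has_vector_derivative_def scaleR_conv_of_real mult.commute)
    have "(u has_derivative D) (at (z + a * of_real 0))" using assms by simp
    thus ?thesis using vector_derivative_diff_chain_within[OF 1, of u D] has_derivative_at_withinI[of u D]
      by (simp add: o_def)
  qed
  from this[of 1] this[of \<i>] show "partial_x u z = D 1" "partial_y u z = D \<i>"
    by (simp_all add: partial_x_def partial_y_def vector_derivative_at)
qed

lemma differentiable_has_derivative_partials: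
  assumes "u differentiable (at z)"
  shows "(u has_derivative (\<lambda>h. Re h *\<^sub>R partial_x u z + Im h *\<^sub>R partial_y u z)) (at z)"
proof -
  obtain D where D: "(u has_derivative D) (at z)"
    using assms by (auto simp: differentiable_def)
  interpret D: linear D using D by (rule has_derivative_linear)
  have "D h = Re h *\<^sub>R partial_x u z + Im h *\<^sub>R partial_y u z" for h
  proof -
    have "h = Re h *\<^sub>R 1 + Im h *\<^sub>R \<i>"
      by (simp add: complex_eq_iff)
    hence "D h = D (Re h *\<^sub>R 1 + Im h *\<^sub>R \<i>)" by simp
    thus ?thesis by (simp only: D.add D.scaleR has_derivative_partials[OF D])
  qed
  thus ?thesis using D by presburger
qed

lemma has_real_derivative_along:
  assumes "u differentiable (at (z + Complex x y))"
  shows "((\<lambda>x. Re (u (z + Complex x y))) has_real_derivative Re (partial_x u (z + Complex x y))) (at x)"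
    and "((\<lambda>x. Im (u (z + Complex x y))) has_real_derivative Im (partial_x u (z + Complex x y))) (at x)"
    and "((\<lambda>y. Re (u (z + Complex x y))) has_real_derivative Re (partial_y u (z + Complex x y))) (at y)"
    and "((\<lambda>y. Im (u (z + Complex x y))) has_real_derivative Im (partial_y u (z + Complex x y))) (at y)"
proof -
  let ?w = "z + Complex x y"
  note D = differentiable_has_derivative_partials[OF assms]
  have 1: "((\<lambda>x. z + Complex x y) has_vector_derivative 1) (at x)"
    unfolding Complex_eq
    by (auto intro!: derivative_eq_intros simp: has_vector_derivative_def scaleR_conv_of_real)
  have 2: "((\<lambda>y. z + Complex x y) has_vector_derivative \<i>) (at y)"
    unfolding Complex_eq
    by (auto intro!: derivative_eq_intros simp: has_vector_derivative_def scaleR_conv_of_real mult.commute)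
  have 3: "((\<lambda>x. u (z + Complex x y)) has_vector_derivative partial_x u ?w) (at x)"
    using vector_derivative_diff_chain_within[OF 1 has_derivative_at_withinI[OF D]] by (simp add: o_def)
  have 4: "((\<lambda>y. u (z + Complex x y)) has_vector_derivative partial_y u ?w) (at y)"
    using vector_derivative_diff_chain_within[OF 2 has_derivative_at_withinI[OF D]] by (simp add: o_def)
  show "((\<lambda>x. Re (u (z + Complex x y))) has_real_derivative Re (partial_x u ?w)) (at x)"
    "((\<lambda>x. Im (u (z + Complex x y))) has_real_derivative Im (partial_x u ?w)) (at x)"
    using has_derivative_Re[OF 3[unfolded has_vector_derivative_def]] has_derivative_Im[OF 3[unfolded has_vector_derivative_def]]
    by (simp_all add: has_field_derivative_def mult.commute[of _ "Re _"] mult.commute[of _ "Im _"] mult_commute_abs)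
  show "((\<lambda>y. Re (u (z + Complex x y))) has_real_derivative Re (partial_y u ?w)) (at y)"
    "((\<lambda>y. Im (u (z + Complex x y))) has_real_derivative Im (partial_y u ?w)) (at y)"
    using has_derivative_Re[OF 4[unfolded has_vector_derivative_def]] has_derivative_Im[OF 4[unfolded has_vector_derivative_def]]
    by (simp_all add: has_field_derivative_def mult_commute_abs)
qed

section \<open>Symmetry of mixed second partial derivatives\<close>

lemma mixed_difference_MVT:
  fixes g :: "real \<Rightarrow> real \<Rightarrow> real"
  assumes h: "0 < h" "h < e"
    and gx: "\<And>x y. \<bar>x\<bar> < e \<Longrightarrow> \<bar>y\<bar> < e \<Longrightarrow> ((\<lambda>x. g x y) has_real_derivative gx x y) (at x)"
    and gxy: "\<And>x y. \<bar>x\<bar> < e \<Longrightarrow> \<bar>y\<bar> < e \<Longrightarrow> ((\<lambda>y. gx x y) has_real_derivative gxy x y) (at y)"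
  obtains x y where "0 < x" "x < h" "0 < y" "y < h"
    "g h h - g h 0 - g 0 h + g 0 0 = h * h * gxy x y"
proof -
  \<comment> \<open>The mean value theorem is applied in the first variable to the function
    \<open>g x h - g x 0\<close>, and below in the second variable to \<open>gx x\<close>.\<close>
  have "\<exists>x>0. x < h \<and> (g h h - g h 0) - (g 0 h - g 0 0) = (h - 0) * (gx x h - gx x 0)"
    by (rule MVT2) (use h in \<open>auto intro!: derivative_intros gx\<close>)
  then obtain x where x: "0 < x" "x < h" "(g h h - g h 0) - (g 0 h - g 0 0) = h * (gx x h - gx x 0)"
    by auto
  have "\<exists>y>0. y < h \<and> gx x h - gx x 0 = (h - 0) * gxy x y"
    by (rule MVT2) (use h x in \<open>auto intro!: gxy\<close>)
  then obtain y where "0 < y" "y < h" "gx x h - gx x 0 = h * gxy x y"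
    by auto
  with x show ?thesis by (intro that[of x y]) auto
qed

text \<open>Schwarz's theorem: the second difference of \<open>g\<close> over a square of side
  \<open>h\<close> equals \<open>h * h\<close> times a value of \<open>gxy\<close>, and also
  \<open>h * h\<close> times a value of \<open>gyx\<close>, at points of that square. Shrinking the
  square, continuity at the origin identifies the two limits.\<close>

lemma mixed_partials_eq:
  fixes g :: "real \<Rightarrow> real \<Rightarrow> real"
  assumes e: "0 < e"
    and gx: "\<And>x y. \<bar>x\<bar> < e \<Longrightarrow> \<bar>y\<bar> < e \<Longrightarrow> ((\<lambda>x. g x y) has_real_derivative gx x y) (at x)"
    and gy: "\<And>x y. \<bar>x\<bar> < e \<Longrightarrow> \<bar>y\<bar> < e \<Longrightarrow> ((\<lambda>y. g x y) has_real_derivative gy x y) (at y)"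
    and gxy: "\<And>x y. \<bar>x\<bar> < e \<Longrightarrow> \<bar>y\<bar> < e \<Longrightarrow> ((\<lambda>y. gx x y) has_real_derivative gxy x y) (at y)"
    and gyx: "\<And>x y. \<bar>x\<bar> < e \<Longrightarrow> \<bar>y\<bar> < e \<Longrightarrow> ((\<lambda>x. gy x y) has_real_derivative gyx x y) (at x)"
    and cxy: "\<And>d. 0 < d \<Longrightarrow> \<exists>r>0. \<forall>x y. \<bar>x\<bar> < r \<longrightarrow> \<bar>y\<bar> < r \<longrightarrow> \<bar>gxy x y - gxy 0 0\<bar> < d"
    and cyx: "\<And>d. 0 < d \<Longrightarrow> \<exists>r>0. \<forall>x y. \<bar>x\<bar> < r \<longrightarrow> \<bar>y\<bar> < r \<longrightarrow> \<bar>gyx x y - gyx 0 0\<bar> < d"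
  shows "gxy 0 0 = gyx 0 0"
proof (rule ccontr)
  assume "gxy 0 0 \<noteq> gyx 0 0"
  \<comment> \<open>With \<open>d\<close> half the gap, a common value within \<open>d\<close> of
    both \<open>gxy 0 0\<close> and \<open>gyx 0 0\<close> contradicts the triangle
    inequality.\<close>
  define d where "d = \<bar>gxy 0 0 - gyx 0 0\<bar> / 2"
  have d: "0 < d" using \<open>gxy 0 0 \<noteq> gyx 0 0\<close> by (simp add: d_def)
  obtain r1 where r1: "r1 > 0" "\<And>x y. \<bar>x\<bar> < r1 \<Longrightarrow> \<bar>y\<bar> < r1 \<Longrightarrow> \<bar>gxy x y - gxy 0 0\<bar> < d"
    using cxy[OF d] by blast
  obtain r2 where r2: "r2 > 0" "\<And>x y. \<bar>x\<bar> < r2 \<Longrightarrow> \<bar>y\<bar> < r2 \<Longrightarrow> \<bar>gyx x y - gyx 0 0\<bar> < d"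
    using cyx[OF d] by blast
  define h where "h = min e (min r1 r2) / 2"
  have h: "0 < h" "h < e" "h < r1" "h < r2"
    using e r1(1) r2(1) by (auto simp: h_def min_def)
  obtain x y where xy: "0 < x" "x < h" "0 < y" "y < h"
    "g h h - g h 0 - g 0 h + g 0 0 = h * h * gxy x y"
    by (rule mixed_difference_MVT[OF h(1,2), of g gx gxy]) (use gx gxy in auto)
  \<comment> \<open>The second difference is symmetric in the two variables, so the same lemma
    applies with their roles exchanged.\<close>
  obtain y' x' where xy': "0 < y'" "y' < h" "0 < x'" "x' < h"
    "g h h - g 0 h - g h 0 + g 0 0 = h * h * gyx x' y'"
    by (rule mixed_difference_MVT[OF h(1,2), of "\<lambda>y x. g x y" "\<lambda>y x. gy x y" "\<lambda>y x. gyx x y"])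
      (use gy gyx in auto)
  have "h * h * gxy x y = h * h * gyx x' y'" using xy(5) xy'(5) by linarith
  hence "gxy x y = gyx x' y'" using h by simp
  moreover have "\<bar>gxy x y - gxy 0 0\<bar> < d" "\<bar>gyx x' y' - gyx 0 0\<bar> < d"
    using xy xy' h by (auto intro!: r1 r2)
  moreover have "\<bar>a - b\<bar> \<le> \<bar>c - a\<bar> + \<bar>c - b\<bar>" for a b c :: real by arith
  ultimately show False using d_def by (metis add_strict_mono field_sum_of_halves not_le)
qed

text \<open>Real and imaginary parts are treated separately, since the mean value theorem behind the
  symmetry is one for real-valued functions.\<close>

lemma partials_commute:
  assumes S: "open S" "z \<in> S" and u: "C2_on S u"
  shows "partial_y (partial_x u) z = partial_x (partial_y u) z"
proof -
  obtain e where e: "e > 0" "ball z e \<subseteq> S"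
    using S open_contains_ball by blast
  have mem: "z + Complex x y \<in> S" if "\<bar>x\<bar> < e / 2" "\<bar>y\<bar> < e / 2" for x y
  proof -
    have "cmod (Complex x y) \<le> \<bar>x\<bar> + \<bar>y\<bar>" using cmod_le[of "Complex x y"] by simp
    thus ?thesis using that e by (auto simp: dist_norm subset_iff)
  qed
  have d: "u differentiable (at w)" "partial_x u differentiable (at w)" "partial_y u differentiable (at w)"
    if "w \<in> S" for w
    using u that S(1) by (auto simp: C2_on_def differentiable_on_eq_differentiable_at)
  have c: "\<exists>r>0. \<forall>x y. \<bar>x\<bar> < r \<longrightarrow> \<bar>y\<bar> < r \<longrightarrow> cmod (v (z + Complex x y) - v (z + Complex 0 0)) < d"
    if v: "continuous_on S v" "d > 0" for v :: "complex \<Rightarrow> complex" and d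
  proof -
    have "isCont v z" using v(1) S by (simp add: continuous_on_eq_continuous_at)
    then obtain r where r: "r > 0" "\<And>w. dist w z < r \<Longrightarrow> dist (v w) (v z) < d"
      using v(2) by (auto simp: continuous_at_eps_delta)
    have "cmod (v (z + Complex x y) - v (z + Complex 0 0)) < d"
      if xy: "\<bar>x\<bar> < r / 2" "\<bar>y\<bar> < r / 2" for x y
    proof -
      have "cmod (Complex x y) < r"
        using cmod_le[of "Complex x y"] xy by simp
      thus ?thesis using r(2)[of "z + Complex x y"] by (simp add: dist_norm Complex_eq)
    qed
    thus ?thesis using r(1) by (intro exI[of _ "r / 2"]) auto
  qed
  have cR: "\<exists>r>0. \<forall>x y. \<bar>x\<bar> < r \<longrightarrow> \<bar>y\<bar> < r \<longrightarrow> \<bar>Re (v (z + Complex x y)) - Re (v (z + Complex 0 0))\<bar> < d"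
    and cI: "\<exists>r>0. \<forall>x y. \<bar>x\<bar> < r \<longrightarrow> \<bar>y\<bar> < r \<longrightarrow> \<bar>Im (v (z + Complex x y)) - Im (v (z + Complex 0 0))\<bar> < d"
    if v: "continuous_on S v" "d > 0" for v :: "complex \<Rightarrow> complex" and d
  proof -
    obtain r where r: "r > 0" "\<And>x y. \<bar>x\<bar> < r \<Longrightarrow> \<bar>y\<bar> < r \<Longrightarrow> cmod (v (z + Complex x y) - v (z + Complex 0 0)) < d"
      using c[OF v] by blast
    have "\<bar>Re (v (z + Complex x y)) - Re (v (z + Complex 0 0))\<bar> < d"
      "\<bar>Im (v (z + Complex x y)) - Im (v (z + Complex 0 0))\<bar> < d"
      if "\<bar>x\<bar> < r" "\<bar>y\<bar> < r" for x y
      using r(2)[OF that] abs_Re_le_cmod[of "v (z + Complex x y) - v (z + Complex 0 0)"]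
        abs_Im_le_cmod[of "v (z + Complex x y) - v (z + Complex 0 0)"] by auto
    thus "\<exists>r>0. \<forall>x y. \<bar>x\<bar> < r \<longrightarrow> \<bar>y\<bar> < r \<longrightarrow> \<bar>Re (v (z + Complex x y)) - Re (v (z + Complex 0 0))\<bar> < d"
      "\<exists>r>0. \<forall>x y. \<bar>x\<bar> < r \<longrightarrow> \<bar>y\<bar> < r \<longrightarrow> \<bar>Im (v (z + Complex x y)) - Im (v (z + Complex 0 0))\<bar> < d"
      using r(1) by blast+
  qed
  have cc: "continuous_on S (partial_y (partial_x u))" "continuous_on S (partial_x (partial_y u))"
    using u by (auto simp: C2_on_def)
  have e2: "0 < e / 2" using e(1) by simp
  have "Re (partial_y (partial_x u) (z + Complex 0 0)) = Re (partial_x (partial_y u) (z + Complex 0 0))"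
    by (rule mixed_partials_eq[of "e / 2" "\<lambda>x y. Re (u (z + Complex x y))"
        "\<lambda>x y. Re (partial_x u (z + Complex x y))" "\<lambda>x y. Re (partial_y u (z + Complex x y))"
        "\<lambda>x y. Re (partial_y (partial_x u) (z + Complex x y))"
        "\<lambda>x y. Re (partial_x (partial_y u) (z + Complex x y))"])
      (rule e2 has_real_derivative_along d mem cR cc | assumption)+
  moreover have "Im (partial_y (partial_x u) (z + Complex 0 0)) = Im (partial_x (partial_y u) (z + Complex 0 0))"
    by (rule mixed_partials_eq[of "e / 2" "\<lambda>x y. Im (u (z + Complex x y))"
        "\<lambda>x y. Im (partial_x u (z + Complex x y))" "\<lambda>x y. Im (partial_y u (z + Complex x y))"
        "\<lambda>x y. Im (partial_y (partial_x u) (z + Complex x y))"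
        "\<lambda>x y. Im (partial_x (partial_y u) (z + Complex x y))"])
      (rule e2 has_real_derivative_along d mem cI cc | assumption)+
  ultimately show ?thesis by (simp add: complex_eq_iff Complex_eq)
qed

lemma Cauchy_Riemann_imp_DERIV:
  assumes "f differentiable (at z)" "partial_y f z = \<i> * partial_x f z"
  shows "(f has_field_derivative partial_x f z) (at z)"
proof -
  have "(\<lambda>h. Re h *\<^sub>R partial_x f z + Im h *\<^sub>R partial_y f z) = (*) (partial_x f z)"
    unfolding assms(2) by (auto simp: fun_eq_iff complex_eq_iff algebra_simps)
  thus ?thesis
    using differentiable_has_derivative_partials[OF assms(1)] by (simp add: has_field_derivative_def)
qed

text \<open>The function \<open>f\<close> is the Wirtinger derivative of \<open>u\<close> with
  respect to \<open>z\<close>. Laplace's equation and the symmetry of the mixed partials are its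
  Cauchy-Riemann equations, so it is holomorphic and has a primitive \<open>F\<close> on the convex
  set. Then \<open>u - F\<close> has zero derivative with respect to \<open>z\<close>, that is, it
  is antiholomorphic.\<close>

lemma harmonic_imp_holomorphic_decomposition:
  assumes S: "open S" "convex S" and u: "harmonic_on S u"
  obtains F G where "F holomorphic_on S" "G holomorphic_on S" "\<And>z. z \<in> S \<Longrightarrow> u z = F z + cnj (G z)"
proof -
  let ?ux = "partial_x u" and ?uy = "partial_y u"
  have C2: "C2_on S u" using u by (simp add: harmonic_on_def)
  have d: "(u has_derivative (\<lambda>h. Re h *\<^sub>R ?ux z + Im h *\<^sub>R ?uy z)) (at z)"
    "(?ux has_derivative (\<lambda>h. Re h *\<^sub>R partial_x ?ux z + Im h *\<^sub>R partial_y ?ux z)) (at z)"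
    "(?uy has_derivative (\<lambda>h. Re h *\<^sub>R partial_x ?uy z + Im h *\<^sub>R partial_y ?uy z)) (at z)"
    if "z \<in> S" for z
    using C2 that S(1)
    by (auto simp: C2_on_def differentiable_on_eq_differentiable_at intro!: differentiable_has_derivative_partials)
  define f where "f = (\<lambda>z. (?ux z - \<i> * ?uy z) / 2)"
  have "f holomorphic_on S"
    unfolding holomorphic_on_open[OF S(1)]
  proof
    fix z assume z: "z \<in> S"
    have fd: "(f has_derivative (\<lambda>h. ((Re h *\<^sub>R partial_x ?ux z + Im h *\<^sub>R partial_y ?ux z)
        - \<i> * (Re h *\<^sub>R partial_x ?uy z + Im h *\<^sub>R partial_y ?uy z)) / 2)) (at z)"
      unfolding f_def by (rule derivative_eq_intros d[OF z] refl | simp)+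
    have "partial_x ?ux z + partial_y ?uy z = 0"
      using u z by (simp add: harmonic_on_def)
    hence "partial_y ?uy z = - partial_x ?ux z" by (simp add: eq_neg_iff_add_eq_0 add.commute)
    hence "partial_y f z = \<i> * partial_x f z"
      unfolding has_derivative_partials[OF fd]
      by (simp add: partials_commute[OF S(1) z C2] field_simps)
    moreover have "f differentiable (at z)"
      using fd by (auto simp: differentiable_def)
    ultimately show "\<exists>f'. (f has_field_derivative f') (at z)"
      using Cauchy_Riemann_imp_DERIV by blast
  qed
  then obtain F where F: "\<And>z. z \<in> S \<Longrightarrow> (F has_field_derivative f z) (at z)"
    using holomorphic_convex_primitive'[OF S(2,1)] S(1) by (metis at_within_open)
  define G where "G = (\<lambda>z. cnj (u z - F z))"
  have "G holomorphic_on S"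
    unfolding holomorphic_on_open[OF S(1)]
  proof
    fix z assume z: "z \<in> S"
    have Gd: "(G has_derivative (\<lambda>h. cnj ((Re h *\<^sub>R ?ux z + Im h *\<^sub>R ?uy z) - f z * h))) (at z)"
      unfolding G_def
      by (intro has_derivative_cnj has_derivative_diff d[OF z] F[OF z, unfolded has_field_derivative_def])
    have "partial_y G z = \<i> * partial_x G z"
      unfolding has_derivative_partials[OF Gd] f_def
      by (simp add: field_simps)
    moreover have "G differentiable (at z)"
      using Gd by (auto simp: differentiable_def)
    ultimately show "\<exists>f'. (G has_field_derivative f') (at z)"
      using Cauchy_Riemann_imp_DERIV by blast
  qed
  moreover have "F holomorphic_on S"
    using F S(1) by (auto simp: holomorphic_on_open)
  ultimately show ?thesis by (intro that[of F G]) (auto simp: G_def)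
qed

text \<open>Each partial derivative is again a holomorphic function plus the conjugate of one, so
  the lemma can be applied to the partials in turn. The factor \<i> is kept inside the conjugate for
  that purpose.\<close>

lemma holomorphic_decomposition_partials:
  assumes S: "open S" and FG: "F holomorphic_on S" "G holomorphic_on S"
    and u: "\<And>z. z \<in> S \<Longrightarrow> u z = F z + cnj (G z)"
  shows "u differentiable_on S"
    and "z \<in> S \<Longrightarrow> partial_x u z = deriv F z + cnj (deriv G z)"
    and "z \<in> S \<Longrightarrow> partial_y u z = \<i> * deriv F z + cnj (\<i> * deriv G z)"
proof -
  have D: "(u has_derivative (\<lambda>h. deriv F z * h + cnj (deriv G z * h))) (at z)" if z: "z \<in> S" for z
  proof -
    have "(F has_derivative (\<lambda>h. deriv F z * h)) (at z)" "(G has_derivative (\<lambda>h. deriv G z * h)) (at z)"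
      using holomorphic_derivI[OF FG(1) S z] holomorphic_derivI[OF FG(2) S z]
      by (simp_all add: has_field_derivative_def)
    hence "((\<lambda>z. F z + cnj (G z)) has_derivative (\<lambda>h. deriv F z * h + cnj (deriv G z * h))) (at z)"
      by (intro has_derivative_add has_derivative_cnj)
    thus ?thesis
      by (rule has_derivative_transform_within_open[OF _ S z]) (simp add: u)
  qed
  show "u differentiable_on S"
    unfolding differentiable_on_eq_differentiable_at[OF S] using D by (auto simp: differentiable_def)
  show "z \<in> S \<Longrightarrow> partial_x u z = deriv F z + cnj (deriv G z)"
    and "z \<in> S \<Longrightarrow> partial_y u z = \<i> * deriv F z + cnj (\<i> * deriv G z)"
    using has_derivative_partials[OF D] by (simp_all add: mult.commute)
qed

text \<open>Two derivatives in the vertical direction produce the factor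
  \<open>\<i> * \<i> = -1\<close> relative to two in the horizontal direction, so the second
  partials cancel.\<close>

lemma holomorphic_decomposition_imp_harmonic:
  assumes S: "open S" and FG: "F holomorphic_on S" "G holomorphic_on S"
    and u: "\<And>z. z \<in> S \<Longrightarrow> u z = F z + cnj (G z)"
  shows "harmonic_on S u"
proof -
  note p = holomorphic_decomposition_partials[OF S]
  note px = p(2)[OF FG u] and py = p(3)[OF FG u]
  have h: "deriv F holomorphic_on S" "deriv G holomorphic_on S"
    "(\<lambda>z. \<i> * deriv F z) holomorphic_on S" "(\<lambda>z. \<i> * deriv G z) holomorphic_on S"
    using FG S by (auto intro!: holomorphic_intros)
  have h2: "continuous_on S (\<lambda>z. deriv f z)" if "f holomorphic_on S" for f
    using that S by (intro holomorphic_on_imp_continuous_on holomorphic_deriv)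
  have c: "continuous_on S v \<longleftrightarrow> continuous_on S w" if "\<And>z. z \<in> S \<Longrightarrow> v z = w z" for v w :: "complex \<Rightarrow> complex"
    using that by (intro continuous_on_cong) auto
  have dd: "deriv (\<lambda>z. \<i> * deriv f z) z = \<i> * deriv (deriv f) z" if "f holomorphic_on S" "z \<in> S" for f z
    using that S by (intro deriv_cmult holomorphic_on_imp_differentiable_at[OF holomorphic_deriv[OF that(1) S] S])
  have "partial_x (partial_x u) z + partial_y (partial_y u) z = 0" if z: "z \<in> S" for z
  proof -
    have "partial_x (partial_x u) z = deriv (deriv F) z + cnj (deriv (deriv G) z)"
      by (rule p(2)[OF h(1,2) px z])
    moreover have "partial_y (partial_y u) z = - deriv (deriv F) z - cnj (deriv (deriv G) z)"
      using p(3)[OF h(3,4) py z] by (simp add: dd[OF FG(1) z] dd[OF FG(2) z] mult.assoc[symmetric])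
    ultimately show ?thesis by simp
  qed
  moreover have "C2_on S u"
    unfolding C2_on_def
    using p(1)[OF FG u] p(1)[OF h(1,2) px] p(1)[OF h(3,4) py]
      h2[OF h(1)] h2[OF h(2)] h2[OF h(3)] h2[OF h(4)]
    by (auto simp: c[OF p(2)[OF h(1,2) px]] c[OF p(3)[OF h(1,2) px]] c[OF p(2)[OF h(3,4) py]]
        c[OF p(3)[OF h(3,4) py]] intro!: continuous_intros)
  ultimately show ?thesis by (simp add: harmonic_on_def)
qed

subsection \<open>Uniqueness of bounded holomorphic functions on a half-plane\<close>

lemma open_right_half_plane: "open {s. 0 < Re s}"
  by (simp add: open_halfspace_Re_gt)

text \<open>The half-plane is a countable union of closed half-planes. This is the topological
  condition under which the zeros of a nonconstant holomorphic function on it are shown to be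
  countable.\<close>

lemma fsigma_right_half_plane: "fsigma {s. 0 < Re s}"
proof -
  have "{s. 0 < Re s} = (\<Union>n. {s. inverse (real (Suc n)) \<le> Re s})"
  proof (intro equalityI subsetI)
    fix s :: complex assume "s \<in> {s. 0 < Re s}"
    then obtain n where "inverse (real (Suc n)) < Re s"
      using reals_Archimedean[of "Re s"] by auto
    thus "s \<in> (\<Union>n. {s. inverse (real (Suc n)) \<le> Re s})" by (auto intro: less_imp_le)
  next
    fix s :: complex assume "s \<in> (\<Union>n. {s. inverse (real (Suc n)) \<le> Re s})"
    then obtain n where "inverse (real (Suc n)) \<le> Re s" by blast
    moreover have "0 < inverse (real (Suc n))" by simp
    ultimately show "s \<in> {s. 0 < Re s}" by (simp only: mem_Collect_eq)
  qed
  moreover have "fsigma (\<Union>n. {s. inverse (real (Suc n)) \<le> Re s})"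
    by (intro fsigma.intros closed_halfspace_Re_ge)
  ultimately show ?thesis by simp
qed

text \<open>The Cayley transform \<open>f\<close> maps the unit disk into the half-plane and sends 0
  to \<open>a\<close>; the preimage of \<open>s\<close> is \<open>(s - a) / (s + a)\<close>. The
  claim is the Schwarz lemma for \<open>P\<close> composed with \<open>f\<close>.\<close>

lemma right_half_plane_Schwarz:
  assumes hol: "P holomorphic_on {s. 0 < Re s}" and M: "\<And>s. 0 < Re s \<Longrightarrow> cmod (P s) \<le> M"
    and a: "0 < a" and Pa: "P (of_real a) = 0" and s: "0 < Re s"
  shows "cmod (P s) \<le> M * cmod ((s - of_real a) / (s + of_real a))"
proof -
  define f :: "complex \<Rightarrow> complex" where "f = (\<lambda>w. of_real a * (1 + w) / (1 - w))"
  have f: "0 < Re (f w)" if "cmod w < 1" for w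
  proof -
    have w1: "w \<noteq> 1" using that by auto
    have "f w = (a / (cmod (1 - w))\<^sup>2) *\<^sub>R ((1 + w) * cnj (1 - w))"
      using w1 unfolding scaleR_conv_of_real of_real_divide complex_norm_square by (simp add: f_def divide_simps)
    hence "Re (f w) = a / (cmod (1 - w))\<^sup>2 * Re ((1 + w) * cnj (1 - w))"
      by (simp only: scaleR_complex.sel)
    also have "Re ((1 + w) * cnj (1 - w)) = 1 - (cmod w)\<^sup>2"
      unfolding cmod_power2 by (simp add: algebra_simps power2_eq_square)
    also have "0 < a / (cmod (1 - w))\<^sup>2 * (1 - (cmod w)\<^sup>2)"
      using a w1 that by (intro divide_pos_pos mult_pos_pos) (auto simp: power_less_one_iff)
    finally show ?thesis .
  qed
  define w where "w = (s - of_real a) / (s + of_real a)"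
  have sa: "s + of_real a \<noteq> 0" using s a by (auto simp: complex_eq_iff)
  have w: "cmod w < 1"
  proof -
    have "cmod (s - of_real a) < cmod (s + of_real a)"
      using s a by (simp add: cmod_def power2_eq_square algebra_simps)
    thus ?thesis using sa by (simp add: w_def norm_divide divide_simps)
  qed
  have "1 - w = 2 * of_real a / (s + of_real a)" "1 + w = 2 * s / (s + of_real a)"
    using sa by (simp_all add: w_def divide_simps)
  hence fw: "f w = s"
    using sa a by (simp add: f_def)
  \<comment> \<open>The Schwarz lemma wants values of modulus strictly below 1, so \<open>P\<close>
    is divided by a constant larger than \<open>M\<close>, which tends to \<open>M\<close>
    afterwards.\<close>
  have *: "cmod (P s) \<le> M' * cmod w" if M': "M < M'" for M'
  proof -
    have M'0: "M' > 0" using M' M[OF s] norm_ge_zero[of "P s"] by linarith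
    define g where "g = (\<lambda>w. P (f w) / of_real M')"
    have "cmod (g w) \<le> cmod w"
    proof (rule Schwarz_Lemma(1))
      have "(P \<circ> f) holomorphic_on ball 0 1"
      proof (rule holomorphic_on_compose_gen[OF _ hol])
        show "f holomorphic_on ball 0 1"
          unfolding f_def by (intro holomorphic_intros) auto
      qed (use f in auto)
      thus "g holomorphic_on ball 0 1"
        unfolding g_def using M'0 by (intro holomorphic_intros) (auto simp: o_def)
      show "g 0 = 0" by (simp add: g_def f_def Pa)
      show "cmod (g z) < 1" if "cmod z < 1" for z
        using M[OF f[OF that]] M' M'0 by (simp add: g_def norm_divide)
    qed (fact w)
    thus ?thesis using M'0 by (simp add: g_def fw norm_divide divide_simps mult.commute)
  qed
  show ?thesis
  proof (cases "w = 0")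
    case True
    thus ?thesis using *[of "M + 1"] unfolding w_def[symmetric] by simp
  next
    case False
    have "cmod (P s) / cmod w \<le> M"
      by (rule dense_ge) (use * False in \<open>simp add: divide_simps\<close>)
    thus ?thesis using False by (simp add: w_def[symmetric] divide_simps)
  qed
qed

text \<open>Dividing out the Blaschke factor of a zero does not worsen the bound: away from
  \<open>a\<close> this is exactly the Schwarz estimate.\<close>

lemma right_half_plane_factor_zero:
  assumes hol: "P holomorphic_on {s. 0 < Re s}" and M: "\<And>s. 0 < Re s \<Longrightarrow> cmod (P s) \<le> M"
    and a: "0 < a" and Pa: "P (of_real a) = 0"
  obtains Q where "Q holomorphic_on {s. 0 < Re s}" "\<And>s. 0 < Re s \<Longrightarrow> cmod (Q s) \<le> M"
    "\<And>s. 0 < Re s \<Longrightarrow> P s = (s - of_real a) / (s + of_real a) * Q s"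
proof -
  \<comment> \<open>The derivative fills the removable singularity of the difference quotient at
    \<open>a\<close>.\<close>
  define Q where "Q = (\<lambda>s. (s + of_real a) *
     (if s = of_real a then deriv P (of_real a) else (P s - P (of_real a)) / (s - of_real a)))"
  have Q: "Q holomorphic_on {s. 0 < Re s}"
    unfolding Q_def using a
    by (intro holomorphic_on_mult holomorphic_on_add holomorphic_on_ident holomorphic_on_const pole_lemma[OF hol])
      (simp add: interior_open[OF open_right_half_plane])
  have sa: "s + of_real a \<noteq> 0" if "0 < Re s" for s
    using that a by (auto simp: complex_eq_iff)
  have eq: "P s = (s - of_real a) / (s + of_real a) * Q s" if "0 < Re s" for s
    using sa[OF that] by (auto simp: Q_def Pa)
  have bound: "cmod (Q s) \<le> M" if s: "0 < Re s" "s \<noteq> of_real a" for s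
  proof -
    have "cmod ((s - of_real a) / (s + of_real a)) * cmod (Q s) \<le> M * cmod ((s - of_real a) / (s + of_real a))"
      using right_half_plane_Schwarz[OF hol M a Pa s(1)] unfolding eq[OF s(1)] by (simp only: norm_mult)
    moreover have "cmod ((s - of_real a) / (s + of_real a)) > 0"
      using s sa by simp
    ultimately show ?thesis by (simp add: mult.commute)
  qed
  \<comment> \<open>At \<open>a\<close> itself the factor vanishes and cannot be cancelled, so the
    bound is obtained there by continuity.\<close>
  have "cmod (Q (of_real a)) \<le> M"
  proof (rule tendsto_upperbound)
    show "((\<lambda>s. cmod (Q s)) \<longlongrightarrow> cmod (Q (of_real a))) (at (of_real a))"
      using holomorphic_on_imp_continuous_on[OF Q] a
      by (intro tendsto_norm) (simp add: continuous_on_eq_continuous_at[OF open_right_half_plane] isCont_def)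
    have "eventually (\<lambda>s. s \<in> {s. 0 < Re s}) (at (complex_of_real a))"
      using a by (intro eventually_at_in_open' open_right_half_plane) auto
    thus "eventually (\<lambda>s. cmod (Q s) \<le> M) (at (complex_of_real a))"
      using eventually_neq_at_within by eventually_elim (auto intro: bound)
  qed simp
  with bound have "cmod (Q s) \<le> M" if "0 < Re s" for s
    using that by (cases "s = of_real a") auto
  with Q eq show ?thesis by (intro that)
qed

text \<open>One zero is divided out at a time. As the zeros are distinct, the Blaschke factor of one
  does not vanish at the others, which therefore remain zeros of the quotient.\<close>

lemma right_half_plane_Blaschke:
  fixes N :: nat
  assumes "P holomorphic_on {s. 0 < Re s}" "\<And>s. 0 < Re s \<Longrightarrow> cmod (P s) \<le> M"
    and "\<And>j. j < N \<Longrightarrow> 0 < a j" "inj_on a {..<N}" "\<And>j. j < N \<Longrightarrow> P (of_real (a j)) = 0"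
    and "0 < Re s"
  shows "cmod (P s) \<le> M * (\<Prod>j<N. cmod ((s - of_real (a j)) / (s + of_real (a j))))"
  using assms
proof (induction N arbitrary: P)
  case 0
  thus ?case by simp
next
  case (Suc N)
  obtain Q where Q: "Q holomorphic_on {s. 0 < Re s}" "\<And>s. 0 < Re s \<Longrightarrow> cmod (Q s) \<le> M"
    "\<And>s. 0 < Re s \<Longrightarrow> P s = (s - of_real (a N)) / (s + of_real (a N)) * Q s"
    using right_half_plane_factor_zero[OF Suc.prems(1,2), of "a N"] Suc.prems(3)[of N] Suc.prems(5)[of N]
    by auto
  have "Q (of_real (a j)) = 0" if j: "j < N" for j
  proof -
    have "a j > 0" "a N > 0" using Suc.prems(3)[of j] Suc.prems(3)[of N] j by auto
    moreover have "a j \<noteq> a N" using Suc.prems(4) j by (auto simp: inj_on_def)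
    moreover have "a j + a N \<noteq> 0" using calculation by linarith
    ultimately show ?thesis
      using Q(3)[of "of_real (a j)"] Suc.prems(5)[of j] j
      by (simp del: of_real_add of_real_diff add: of_real_add[symmetric] of_real_diff[symmetric])
  qed
  hence "cmod (Q s) \<le> M * (\<Prod>j<N. cmod ((s - of_real (a j)) / (s + of_real (a j))))"
    using Suc.prems by (intro Suc.IH Q(1,2)) (auto simp: inj_on_def)
  hence "cmod ((s - of_real (a N)) / (s + of_real (a N))) * cmod (Q s)
    \<le> cmod ((s - of_real (a N)) / (s + of_real (a N))) * (M * (\<Prod>j<N. cmod ((s - of_real (a j)) / (s + of_real (a j)))))"
    by (intro mult_left_mono) auto
  thus ?case
    unfolding Q(3)[OF Suc.prems(6)] norm_mult by (simp add: mult_ac)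
qed

text \<open>Blaschke's condition fails for an arithmetic progression: at \<open>x\<close> the first
  \<open>N\<close> factors multiply to at most \<open>exp (- c * harm N)\<close>, which tends to 0
  because the harmonic series diverges.\<close>

lemma right_half_plane_zeros_imp_zero:
  assumes hol: "P holomorphic_on {s. 0 < Re s}" and M: "\<And>s. 0 < Re s \<Longrightarrow> cmod (P s) \<le> M"
    and a: "0 < a" and h: "0 < h" and zero: "\<And>j::nat. P (of_real (a + h * of_nat j)) = 0"
    and x: "0 < x"
  shows "P (of_real x) = 0"
proof -
  \<comment> \<open>The zeros below \<open>x\<close> are skipped, so that each remaining factor has
    modulus \<open>(y - x) / (x + y)\<close> with \<open>y\<close> at least
    \<open>x\<close>.\<close>
  obtain J :: nat where J: "x < real J * h" using reals_Archimedean3[OF h] by blast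
  define b where "b = a + h * real J"
  have b: "0 < b" "x \<le> b" using J a h by (auto simp: b_def mult.commute add_pos_nonneg)
  \<comment> \<open>This constant is small enough that every factor is at most
    \<open>exp (- c / (j + 1))\<close>, since \<open>y\<close> is at most
    \<open>(b + h) * (j + 1)\<close>.\<close>
  define c where "c = x / (b + h)"
  have c: "0 < c" using x b h by (simp add: c_def)
  have factor: "cmod ((of_real x - of_real (b + h * real j)) / (of_real x + of_real (b + h * real j)))
      \<le> exp (- c * (1 / real (Suc j)))" for j
  proof -
    define y where "y = b + h * real j"
    have y: "x \<le> y" "0 < y" using b h by (auto simp: y_def add_increasing2 add_pos_nonneg)
    have "cmod ((of_real x - of_real y) / (of_real x + of_real y)) = (y - x) / (x + y)"
    proof -
      have "(of_real x - of_real y) / (of_real x + of_real y) = complex_of_real ((x - y) / (x + y))" by simp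
      thus ?thesis using x y by (simp only: norm_of_real) (simp add: abs_if divide_simps)
    qed
    also have "\<dots> \<le> 1 - x / y"
      using x y by (simp add: field_simps)
    also have "\<dots> \<le> exp (- (x / y))"
      using exp_ge_add_one_self[of "- (x / y)"] by simp
    also have "\<dots> \<le> exp (- c * (1 / real (Suc j)))"
    proof -
      have "y \<le> (b + h) * real (Suc j)" using b h by (simp add: y_def algebra_simps)
      hence "x / ((b + h) * real (Suc j)) \<le> x / y"
        using x y b h by (intro divide_left_mono mult_pos_pos) auto
      thus ?thesis by (simp add: c_def)
    qed
    finally show ?thesis by (simp add: y_def)
  qed
  have bound: "cmod (P (of_real x)) \<le> M * exp (- c * ln (real N + 1))" for N
  proof -
    have M0: "0 \<le> M" using order_trans[OF norm_ge_zero M[of 1]] by simp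
    have "cmod (P (of_real x)) \<le> M * (\<Prod>j<N. cmod ((of_real x - of_real (b + h * real j)) / (of_real x + of_real (b + h * real j))))"
    proof (rule right_half_plane_Blaschke[OF hol M])
      show "inj_on (\<lambda>j. b + h * real j) {..<N}" using h by (auto simp: inj_on_def)
      show "P (of_real (b + h * real j)) = 0" for j
        using zero[of "J + j"] by (simp add: b_def algebra_simps)
    qed (use b h x in \<open>auto simp: add_pos_nonneg\<close>)
    also have "\<dots> \<le> M * (\<Prod>j<N. exp (- c * (1 / real (Suc j))))"
      using factor M0 by (intro mult_left_mono prod_mono) auto
    also have "(\<Prod>j<N. exp (- c * (1 / real (Suc j)))) = exp (- c * harm N)"
    proof -
      have "harm N = (\<Sum>j<N. 1 / real (Suc j))"
        unfolding harm_def by (rule sum.reindex_bij_witness[of _ Suc "\<lambda>k. k - 1"]) (auto simp: inverse_eq_divide)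
      thus ?thesis by (simp add: exp_sum sum_distrib_left flip: exp_sum)
    qed
    also have "M * exp (- c * harm N) \<le> M * exp (- c * ln (real N + 1))"
      using ln_le_harm[of N] c M0 by (intro mult_left_mono) auto
    finally show ?thesis .
  qed
  have "filterlim (\<lambda>N. ln (real N + 1)) at_top sequentially"
    using filterlim_compose[OF ln_at_top filterlim_tendsto_add_at_top[OF tendsto_const[of 1] filterlim_real_sequentially]]
    by (simp add: add.commute)
  hence "filterlim (\<lambda>N. - c * ln (real N + 1)) at_bot sequentially"
    using c by (simp add: filterlim_uminus_at_bot filterlim_tendsto_pos_mult_at_top[OF tendsto_const])
  hence "(\<lambda>N. M * exp (- c * ln (real N + 1))) \<longlonglongrightarrow> M * 0"
    by (intro tendsto_mult[OF tendsto_const] filterlim_compose[OF exp_at_bot])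
  hence "cmod (P (of_real x)) \<le> 0"
    using bound by (intro tendsto_lowerbound) auto
  thus ?thesis by simp
qed

text \<open>The cross difference \<open>P\<close> vanishes on a progression, hence on the positive
  reals. So \<open>A / B\<close> is unchanged by the shift \<open>d\<close> and constant along a
  progression of step \<open>d\<close> that avoids the zeros of \<open>B\<close>; the zeros of
  \<open>A - c * B\<close> obtained there propagate to all positive reals.\<close>

lemma right_half_plane_proportional:
  assumes A: "A holomorphic_on {s. 0 < Re s}" "\<And>s. 0 < Re s \<Longrightarrow> cmod (A s) \<le> MA"
    and B: "B holomorphic_on {s. 0 < Re s}" "\<And>s. 0 < Re s \<Longrightarrow> cmod (B s) \<le> MB"
    and a: "0 < a" and h: "0 < h" and d: "0 < d"
    and eq: "\<And>j::nat. A (of_real (a + h * of_nat j)) * B (of_real (a + h * of_nat j + d)) =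
                       A (of_real (a + h * of_nat j + d)) * B (of_real (a + h * of_nat j))"
    and B0: "\<exists>x>0. B (of_real x) \<noteq> 0"
  shows "\<exists>c. \<forall>x>0. A (of_real x) = c * B (of_real x)"
proof -
  let ?H = "{s. 0 < Re s}"
  define P where "P = (\<lambda>s. A s * B (s + of_real d) - A (s + of_real d) * B s)"
  have sh: "(\<lambda>s. f (s + of_real d)) holomorphic_on ?H" if "f holomorphic_on ?H" for f
  proof -
    have "(f \<circ> (\<lambda>s. s + of_real d)) holomorphic_on ?H"
      by (rule holomorphic_on_compose_gen[OF _ that]) (use d in \<open>auto intro!: holomorphic_intros\<close>)
    thus ?thesis by (simp add: o_def)
  qed
  have P: "P holomorphic_on ?H"
    unfolding P_def
    by (intro holomorphic_on_diff holomorphic_on_mult A(1) B(1) sh[OF A(1)] sh[OF B(1)])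
  have PM: "cmod (P s) \<le> MA * MB + MA * MB" if s: "0 < Re s" for s
  proof -
    have sd: "0 < Re (s + of_real d)" using s d by simp
    have "cmod (P s) \<le> cmod (A s) * cmod (B (s + of_real d)) + cmod (A (s + of_real d)) * cmod (B s)"
      unfolding P_def by (metis norm_mult norm_triangle_ineq4)
    also have "\<dots> \<le> MA * MB + MA * MB"
      using A(2)[OF s] B(2)[OF s] A(2)[OF sd] B(2)[OF sd]
        order_trans[OF norm_ge_zero A(2)[OF s]]
      by (intro add_mono mult_mono) auto
    finally show ?thesis .
  qed
  have Pz: "A (of_real x) * B (of_real (x + d)) = A (of_real (x + d)) * B (of_real x)" if "0 < x" for x
    using right_half_plane_zeros_imp_zero[OF P PM a h _ that] eq by (simp add: P_def)
  define Z where "Z = {s \<in> ?H. B s = 0}"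
  have "countable Z"
  proof (cases "B constant_on ?H")
    case True
    hence "Z = {}" using B0 by (fastforce simp: Z_def constant_on_def)
    thus ?thesis by simp
  next
    case False
    thus ?thesis unfolding Z_def
      using B(1) by (intro holomorphic_countable_zeros open_right_half_plane convex_connected convex_halfspace_Re_gt)
        (auto intro: fsigma_right_half_plane)
  qed
  \<comment> \<open>A starting point is bad only if some \<open>x0 + d * k\<close> is a zero of
    \<open>B\<close>; countably many zeros and shifts leave good points in any interval.\<close>
  hence "countable (\<Union>k::nat. (\<lambda>s. Re s - d * real k) ` Z)" by auto
  moreover have "uncountable {0<..<1::real}" by (simp add: uncountable_open_interval)
  ultimately have "\<not> {0<..<1} \<subseteq> (\<Union>k::nat. (\<lambda>s. Re s - d * real k) ` Z)"
    using countable_subset by blast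
  then obtain x0 where x0: "0 < x0" "x0 \<notin> (\<Union>k::nat. (\<lambda>s. Re s - d * real k) ` Z)"
    by (auto simp only: subset_iff greaterThanLessThan_iff)
  have nz: "B (of_real (x0 + d * real k)) \<noteq> 0" for k
  proof
    assume "B (of_real (x0 + d * real k)) = 0"
    hence "complex_of_real (x0 + d * real k) \<in> Z"
      using x0(1) d by (simp add: Z_def add_pos_nonneg)
    hence "Re (complex_of_real (x0 + d * real k)) - d * real k \<in> (\<Union>k::nat. (\<lambda>s. Re s - d * real k) ` Z)"
      by blast
    with x0(2) show False by simp
  qed
  define c where "c = A (of_real x0) / B (of_real x0)"
  have prog: "A (of_real (x0 + d * real k)) = c * B (of_real (x0 + d * real k))" for k
  proof (induction k)
    case 0
    thus ?case using nz[of 0] by (simp add: c_def)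
  next
    case (Suc k)
    have e: "x0 + d * real (Suc k) = x0 + d * real k + d" by (simp add: algebra_simps)
    have "0 < x0 + d * real k" using x0(1) d by (simp add: add_pos_nonneg)
    from Pz[OF this] Suc.IH nz[of k] show ?case unfolding e by simp
  qed
  define Q where "Q = (\<lambda>s. A s - c * B s)"
  have "Q (of_real x) = 0" if "0 < x" for x
  proof (rule right_half_plane_zeros_imp_zero[OF _ _ x0(1) d _ that])
    show "Q holomorphic_on ?H" unfolding Q_def by (intro holomorphic_intros A B)
    show "cmod (Q s) \<le> MA + cmod c * MB" if "0 < Re s" for s
    proof -
      have "cmod (Q s) \<le> cmod (A s) + cmod c * cmod (B s)"
        unfolding Q_def by (metis norm_mult norm_triangle_ineq4)
      also have "\<dots> \<le> MA + cmod c * MB"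
        using A(2)[OF that] B(2)[OF that] by (intro add_mono mult_left_mono) auto
      finally show ?thesis .
    qed
    show "Q (of_real (x0 + d * of_nat k)) = 0" for k
      using prog[of k] by (simp add: Q_def)
  qed
  thus ?thesis by (auto simp: Q_def)
qed

subsection \<open>The Mellin transform of a radial function\<close>

lemma continuous_imp_measurable_disk:
  "continuous_on unit_disk f \<Longrightarrow> f \<in> borel_measurable disk_measure"
  unfolding measurable_disk_measure_eq by (rule continuous_imp_measurable_on_sets_lebesgue) auto

lemma borel_imp_measurable_disk:
  assumes "f \<in> borel_measurable borel" shows "f \<in> borel_measurable disk_measure"
  using measurable_compose[OF continuous_imp_measurable_disk[OF continuous_on_id] assms] by simp

lemma disk_integrable_bounded:
  fixes f :: "complex \<Rightarrow> complex"
  assumes "f \<in> borel_measurable disk_measure" "\<And>z. z \<in> unit_disk \<Longrightarrow> cmod (f z) \<le> K"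
  shows "integrable disk_measure f"
  using assms by (intro disk_measure.integrable_const_bound[of _ K] AE_I2) auto

lemma disk_integral_bound:
  fixes f :: "complex \<Rightarrow> complex"
  assumes "f \<in> borel_measurable disk_measure" "\<And>z. z \<in> unit_disk \<Longrightarrow> cmod (f z) \<le> K"
  shows "cmod (LINT z|disk_measure. f z) \<le> K * measure disk_measure unit_disk"
proof -
  have "cmod (LINT z|disk_measure. f z) \<le> (LINT z|disk_measure. cmod (f z))"
    by (rule integral_norm_bound)
  also have "\<dots> \<le> (LINT z|disk_measure. K)"
    using assms by (intro integral_mono integrable_norm disk_integrable_bounded) auto
  finally show ?thesis by (simp add: mult.commute)
qed

text \<open>This is \<open>\<bar>z\<bar>\<^sup>s\<close>, also \<open>0\<close> at \<open>z = 0\<close> when \<open>s = 0\<close>.\<close>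

definition radial_power :: "complex \<Rightarrow> complex \<Rightarrow> complex" where
  "radial_power s z = (if z = 0 then 0 else exp (s * of_real (ln (cmod z))))"

text \<open>For radial \<phi>, polar coordinates turn this into twice the integral of \<phi>(r)
  r^(s+1) over 0 < r < 1, a classical Mellin transform with shifted exponent. As an area integral it
  can be compared directly with inner products on the disk.\<close>

definition Mellin :: "(complex \<Rightarrow> complex) \<Rightarrow> complex \<Rightarrow> complex" where
  "Mellin \<phi> s = (LINT z|disk_measure. \<phi> z * radial_power s z)"

lemma measurable_radial_power: "radial_power s \<in> borel_measurable disk_measure"
  unfolding radial_power_def by (rule borel_imp_measurable_disk) measurable

lemma radial_power_of_nat: "0 < n \<Longrightarrow> radial_power (of_nat n) z = of_real (cmod z ^ n)"
  by (simp add: radial_power_def exp_of_nat_mult exp_of_real del: of_real_power add: of_real_power[symmetric])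

lemma cmod_radial_power_le_1: "0 \<le> Re s \<Longrightarrow> z \<in> unit_disk \<Longrightarrow> cmod (radial_power s z) \<le> 1"
  by (simp add: radial_power_def mult_nonneg_nonpos)

text \<open>With \<open>t = - ln (cmod z)\<close> this absorbs the squared logarithm in a Taylor
  remainder into half of the decay of the radial power. It follows from the quadratic term of the
  exponential series.\<close>

lemma quadratic_exp_bound:
  assumes "0 < c" "0 \<le> (t::real)"
  shows "t\<^sup>2 * exp (- c * t) \<le> 2 / c\<^sup>2"
proof -
  have "1 + c * t + (c * t)\<^sup>2 / 2 \<le> exp (c * t)"
    using assms by (intro exp_lower_Taylor_quadratic) auto
  moreover have "0 \<le> c * t" using assms by simp
  ultimately have "(c * t)\<^sup>2 / 2 \<le> exp (c * t)" by linarith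
  thus ?thesis using assms by (simp add: exp_minus field_simps)
qed

lemma linear_exp_bound:
  assumes "0 < c" "0 \<le> (t::real)"
  shows "t * exp (- c * t) \<le> 1 / c"
proof -
  have "c * t \<le> exp (c * t)"
    using exp_ge_add_one_self[of "c * t"] by linarith
  thus ?thesis using assms by (simp add: exp_minus field_simps)
qed

text \<open>The exponential Taylor remainder is at most
  \<open>cmod h ^ 2 * t ^ 2 * exp (\<bar>Re h\<bar> * t)\<close>. Half of the decay
  \<open>exp (- Re s * t)\<close> absorbs the last factor and the other half absorbs
  \<open>t ^ 2\<close>, which makes the bound uniform in \<open>z\<close>.\<close>

lemma radial_power_Taylor:
  assumes s: "0 < Re s" and h: "cmod h \<le> Re s / 2" and z: "z \<in> unit_disk"
  shows "cmod (radial_power (s + h) z - radial_power s z - h * (of_real (ln (cmod z)) * radial_power s z))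
    \<le> 8 / (Re s)\<^sup>2 * (cmod h)\<^sup>2"
proof (cases "z = 0")
  case False
  define t where "t = - ln (cmod z)"
  have t: "0 \<le> t" using False z by (simp add: t_def)
  let ?w = "- h * of_real t"
  have "radial_power (s + h) z - radial_power s z - h * (of_real (ln (cmod z)) * radial_power s z)
      = exp (- s * of_real t) * (exp ?w - (\<Sum>k\<le>1. ?w ^ k / fact k))"
    using False by (simp add: radial_power_def t_def algebra_simps exp_add)
  hence "cmod (radial_power (s + h) z - radial_power s z - h * (of_real (ln (cmod z)) * radial_power s z))
      = exp (- Re s * t) * cmod (exp ?w - (\<Sum>k\<le>1. ?w ^ k / fact k))"
    by (simp add: norm_mult)
  also have "\<dots> \<le> exp (- Re s * t) * (exp \<bar>Re ?w\<bar> * cmod ?w ^ Suc 1 / fact 1)"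
    by (intro mult_left_mono Taylor_exp) auto
  also have "\<dots> = exp (- Re s * t) * (exp (\<bar>Re h\<bar> * t) * ((cmod h)\<^sup>2 * t\<^sup>2))"
    using t by (simp add: norm_mult abs_mult power2_eq_square mult_ac)
  also have "\<dots> \<le> exp (- Re s * t) * (exp (Re s / 2 * t) * ((cmod h)\<^sup>2 * t\<^sup>2))"
  proof -
    have "\<bar>Re h\<bar> * t \<le> Re s / 2 * t"
      using h t abs_Re_le_cmod[of h] by (intro mult_right_mono) auto
    thus ?thesis by (intro mult_left_mono mult_right_mono) auto
  qed
  also have "\<dots> = (cmod h)\<^sup>2 * (t\<^sup>2 * exp (- (Re s / 2) * t))"
    by (simp add: exp_add[symmetric] mult_ac)
  also have "\<dots> \<le> (cmod h)\<^sup>2 * (2 / (Re s / 2)\<^sup>2)"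
    using s t by (intro mult_left_mono quadratic_exp_bound) auto
  finally show ?thesis by (simp add: power2_eq_square mult_ac)
qed (simp add: radial_power_def)

text \<open>Differentiation under the integral sign: the uniform Taylor estimate puts the difference
  quotient within \<open>C * cmod h\<close> of the integral \<open>D\<close> of the
  derivative.\<close>

lemma holomorphic_Mellin:
  assumes m: "\<phi> \<in> borel_measurable disk_measure" and K: "\<And>z. z \<in> unit_disk \<Longrightarrow> cmod (\<phi> z) \<le> K"
  shows "Mellin \<phi> holomorphic_on {s. 0 < Re s}"
  unfolding holomorphic_on_open[OF open_right_half_plane]
proof
  fix s assume "s \<in> {s. 0 < Re s}"
  hence s: "0 < Re s" by simp
  have K0: "0 \<le> K" using order_trans[OF norm_ge_zero K[of 0]] by simp
  note [measurable] = m measurable_radial_power borel_imp_measurable_disk[of "\<lambda>z. complex_of_real (ln (cmod z))"]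
  have i: "integrable disk_measure (\<lambda>z. \<phi> z * radial_power s z)" if "0 < Re s" for s
    using mult_mono[OF K cmod_radial_power_le_1] that K0
    by (intro disk_integrable_bounded[of _ "K * 1"]) (auto simp: norm_mult)
  have lb: "cmod (of_real (ln (cmod z)) * radial_power s z) \<le> 1 / Re s" if "z \<in> unit_disk" for z
    using linear_exp_bound[OF s, of "- ln (cmod z)"] that s by (auto simp: radial_power_def norm_mult)
  have il: "integrable disk_measure (\<lambda>z. \<phi> z * (of_real (ln (cmod z)) * radial_power s z))"
    using mult_mono[OF K lb] K0
    by (intro disk_integrable_bounded[of _ "K * (1 / Re s)"]) (auto simp: norm_mult)
  define D where "D = (LINT z|disk_measure. \<phi> z * (of_real (ln (cmod z)) * radial_power s z))"
  define C where "C = K * (8 / (Re s)\<^sup>2) * measure disk_measure unit_disk"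
  have bound: "cmod ((Mellin \<phi> (s + h) - Mellin \<phi> s) / h - D) \<le> C * cmod h"
    if h: "h \<noteq> 0" "cmod h < Re s / 2" for h
  proof -
    have "0 < Re (s + h)" using h s abs_Re_le_cmod[of h] by simp
    hence "Mellin \<phi> (s + h) - Mellin \<phi> s - h * D = (LINT z|disk_measure. \<phi> z *
       (radial_power (s + h) z - radial_power s z - h * (of_real (ln (cmod z)) * radial_power s z)))"
      using i[OF s] i[of "s + h"] il
      by (simp add: Mellin_def D_def right_diff_distrib mult.left_commute[of _ h])
    also have "cmod \<dots> \<le> (K * (8 / (Re s)\<^sup>2 * (cmod h)\<^sup>2)) * measure disk_measure unit_disk"
      using mult_mono[OF K radial_power_Taylor[OF s]] h K0
      by (intro disk_integral_bound) (auto simp: norm_mult)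
    finally have "cmod (Mellin \<phi> (s + h) - Mellin \<phi> s - h * D) \<le> C * cmod h * cmod h"
      by (simp add: C_def power2_eq_square mult_ac)
    moreover have "(Mellin \<phi> (s + h) - Mellin \<phi> s) / h - D = (Mellin \<phi> (s + h) - Mellin \<phi> s - h * D) / h"
      using h by (simp add: field_simps)
    ultimately show ?thesis using h by (simp add: norm_divide divide_simps mult.commute[of D])
  qed
  have "((\<lambda>h. (Mellin \<phi> (s + h) - Mellin \<phi> s) / h - D) \<longlongrightarrow> 0) (at 0)"
  proof (rule Lim_null_comparison)
    have "eventually (\<lambda>h. h \<noteq> 0 \<and> cmod h < Re s / 2) (at 0)"
      unfolding eventually_at using s by (intro exI[of _ "Re s / 2"]) auto
    thus "eventually (\<lambda>h. cmod ((Mellin \<phi> (s + h) - Mellin \<phi> s) / h - D) \<le> C * cmod h) (at 0)"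
      by eventually_elim (use bound in blast)
    show "((\<lambda>h. C * cmod h) \<longlongrightarrow> 0) (at 0)"
      by (auto intro!: tendsto_eq_intros)
  qed
  hence "(Mellin \<phi> has_field_derivative D) (at s)"
    unfolding DERIV_def by (simp add: LIM_zero_iff)
  thus "\<exists>D. (Mellin \<phi> has_field_derivative D) (at s)" by blast
qed

lemma cmod_Mellin_le:
  assumes m: "\<phi> \<in> borel_measurable disk_measure" and K: "\<And>z. z \<in> unit_disk \<Longrightarrow> cmod (\<phi> z) \<le> K"
    and s: "0 \<le> Re s"
  shows "cmod (Mellin \<phi> s) \<le> K * measure disk_measure unit_disk"
proof -
  have "0 \<le> K" using order_trans[OF norm_ge_zero K[of 0]] by simp
  note [measurable] = m measurable_radial_power
  show ?thesis unfolding Mellin_def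
    using mult_mono[OF K cmod_radial_power_le_1[OF s]] \<open>0 \<le> K\<close>
    by (intro disk_integral_bound) (auto simp: norm_mult)
qed

subsection \<open>The harmonic Bergman space\<close>

lemma borel_measurable_cnj [measurable (raw)]:
  "f \<in> borel_measurable M \<Longrightarrow> (\<lambda>x. cnj (f x)) \<in> borel_measurable M"
  by (rule measurable_compose[of f M borel cnj]) (auto intro!: borel_measurable_continuous_onI continuous_intros)

text \<open>These are the functions \<open>e\<^sub>k\<close> of the introduction, cut off outside
  the disk to match the normalization of \<open>harmonic_Bergman\<close>.\<close>

definition harmonic_monomial :: "int \<Rightarrow> complex \<Rightarrow> complex" where
  "harmonic_monomial k z =
     (if z \<in> unit_disk then if 0 \<le> k then z ^ nat k else cnj z ^ nat (- k) else 0)"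

lemma harmonic_monomial_polar:
  assumes "z \<in> unit_disk"
  shows "harmonic_monomial k z = of_real (cmod z ^ nat \<bar>k\<bar>) * cis (of_int k * Arg z)"
proof -
  have z: "z = of_real (cmod z) * cis (Arg z)"
    using rcis_cmod_Arg[of z] by (simp add: rcis_def)
  hence cz: "cnj z = of_real (cmod z) * cis (- Arg z)"
    by (metis complex_cnj_complex_of_real complex_cnj_mult cis_cnj)
  have "z ^ n = of_real (cmod z ^ n) * cis (real n * Arg z)" for n
    by (subst z) (simp add: power_mult_distrib Complex.DeMoivre)
  moreover have "cnj z ^ n = of_real (cmod z ^ n) * cis (- real n * Arg z)" for n
    by (subst cz) (simp add: power_mult_distrib Complex.DeMoivre)
  ultimately show ?thesis using assms by (auto simp: harmonic_monomial_def)
qed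

lemma cmod_harmonic_monomial: "z \<in> unit_disk \<Longrightarrow> cmod (harmonic_monomial k z) = cmod z ^ nat \<bar>k\<bar>"
  by (auto simp: harmonic_monomial_def norm_power)

lemma cmod_harmonic_monomial_le_1: "z \<in> unit_disk \<Longrightarrow> cmod (harmonic_monomial k z) \<le> 1"
  by (simp add: cmod_harmonic_monomial power_le_one)

lemma measurable_harmonic_monomial: "harmonic_monomial k \<in> borel_measurable disk_measure"
proof (rule continuous_imp_measurable_disk)
  have "continuous_on unit_disk (\<lambda>z::complex. if 0 \<le> k then z ^ nat k else cnj z ^ nat (- k))"
    by (cases "0 \<le> k") (auto intro!: continuous_intros)
  thus "continuous_on unit_disk (harmonic_monomial k)"
    by (rule continuous_on_eq) (simp add: harmonic_monomial_def)
qed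

text \<open>On the unit circle inversion is conjugation; this matches integer powers with the two
  branches of \<open>harmonic_monomial\<close>.\<close>

lemma unit_powi: "cmod w = 1 \<Longrightarrow> w powi k = (if 0 \<le> k then w ^ nat k else cnj w ^ nat (- k))"
proof -
  assume "cmod w = 1"
  hence "w * cnj w = 1" by (simp add: complex_norm_square[symmetric])
  hence "inverse w = cnj w" by (rule inverse_unique)
  thus ?thesis by (simp add: power_int_def)
qed

lemma harmonic_monomial_rotate:
  assumes "cmod w = 1"
  shows "harmonic_monomial k (w * z) = w powi k * harmonic_monomial k z"
  using assms by (simp add: harmonic_monomial_def unit_powi norm_mult power_mult_distrib)

lemma cnj_unit_powi: "cmod w = 1 \<Longrightarrow> cnj (w powi k) * w powi l = w powi (l - k)"
proof -
  assume w: "cmod w = 1"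
  hence w0: "w \<noteq> 0" by auto
  have "w powi k * cnj (w powi k) = 1"
    unfolding complex_norm_square[symmetric] using w by (simp add: norm_power_int)
  hence "cnj (w powi k) * w powi k = 1" by (simp only: mult.commute)
  hence "cnj (w powi k) * (w powi k * w powi (l - k)) = w powi (l - k)"
    by (simp add: mult.assoc[symmetric])
  thus ?thesis using w0 by (simp add: power_int_add[symmetric])
qed

section \<open>Square-integrable functions and elements of the harmonic Bergman space\<close>

lemma L2_iff:
  "f \<in> L2 disk_measure \<longleftrightarrow> f \<in> borel_measurable disk_measure \<and> integrable disk_measure (\<lambda>z. (cmod (f z))\<^sup>2)"
  by (simp add: L2_def)

lemma L2_bounded:
  assumes f: "f \<in> borel_measurable disk_measure" and K: "\<And>z. z \<in> unit_disk \<Longrightarrow> cmod (f z) \<le> K"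
  shows "f \<in> L2 disk_measure"
proof -
  have "integrable disk_measure (\<lambda>z. (cmod (f z))\<^sup>2)"
  proof (rule disk_measure.integrable_const_bound[of _ "K\<^sup>2"])
    show "AE z in disk_measure. norm ((cmod (f z))\<^sup>2) \<le> K\<^sup>2"
      using K by (intro AE_I2) (auto intro: power_mono)
  qed (use f in measurable)
  thus ?thesis using f by (simp add: L2_iff)
qed

lemma L2_diff:
  assumes "f \<in> L2 disk_measure" "g \<in> L2 disk_measure"
  shows "(\<lambda>z. f z - g z) \<in> L2 disk_measure"
proof -
  have [measurable]: "f \<in> borel_measurable disk_measure" "g \<in> borel_measurable disk_measure"
    using assms by (auto simp: L2_iff)
  have "integrable disk_measure (\<lambda>z. (cmod (f z - g z))\<^sup>2)"
  proof (rule Bochner_Integration.integrable_bound)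
    show "integrable disk_measure (\<lambda>z. 2 * (cmod (f z))\<^sup>2 + 2 * (cmod (g z))\<^sup>2)"
      using assms by (auto simp: L2_iff)
    have "(cmod (a - b))\<^sup>2 \<le> 2 * (cmod a)\<^sup>2 + 2 * (cmod b)\<^sup>2" for a b
    proof -
      have "(cmod (a - b))\<^sup>2 \<le> (cmod a + cmod b)\<^sup>2"
        by (intro power_mono norm_triangle_ineq4) auto
      also have "\<dots> \<le> 2 * (cmod a)\<^sup>2 + 2 * (cmod b)\<^sup>2"
        using sum_squares_bound[of "cmod a" "cmod b"] by (simp add: power2_sum)
      finally show ?thesis .
    qed
    thus "AE z in disk_measure. norm ((cmod (f z - g z))\<^sup>2) \<le> norm (2 * (cmod (f z))\<^sup>2 + 2 * (cmod (g z))\<^sup>2)"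
      by simp
  qed measurable
  thus ?thesis by (simp add: L2_iff)
qed

lemma L2_integrable_mult_cnj:
  assumes "f \<in> L2 disk_measure" "g \<in> L2 disk_measure"
  shows "integrable disk_measure (\<lambda>z. f z * cnj (g z))"
proof (rule Bochner_Integration.integrable_bound)
  have [measurable]: "f \<in> borel_measurable disk_measure" "g \<in> borel_measurable disk_measure"
    using assms by (auto simp: L2_iff)
  show "integrable disk_measure (\<lambda>z. (cmod (f z))\<^sup>2 + (cmod (g z))\<^sup>2)"
    using assms by (auto simp: L2_iff)
  have "cmod a * cmod b \<le> (cmod a)\<^sup>2 + (cmod b)\<^sup>2" for a b
  proof -
    have "0 \<le> cmod a * cmod b" by simp
    thus ?thesis using sum_squares_bound[of "cmod a" "cmod b"] by linarith
  qed
  thus "AE z in disk_measure. norm (f z * cnj (g z)) \<le> norm ((cmod (f z))\<^sup>2 + (cmod (g z))\<^sup>2)"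
    by (simp add: norm_mult)
  show "(\<lambda>z. f z * cnj (g z)) \<in> borel_measurable disk_measure" by measurable
qed

text \<open>From here on harmonicity enters only through this decomposition into holomorphic and
  antiholomorphic parts.\<close>

lemma harmonic_Bergman_iff:
  "u \<in> harmonic_Bergman \<longleftrightarrow> u \<in> L2 disk_measure \<and> (\<forall>z. z \<notin> unit_disk \<longrightarrow> u z = 0) \<and>
     (\<exists>F G. F holomorphic_on unit_disk \<and> G holomorphic_on unit_disk \<and>
            (\<forall>z\<in>unit_disk. u z = F z + cnj (G z)))"
proof -
  have "harmonic_on unit_disk u \<longleftrightarrow> (\<exists>F G. F holomorphic_on unit_disk \<and> G holomorphic_on unit_disk \<and>
            (\<forall>z\<in>unit_disk. u z = F z + cnj (G z)))"
    using harmonic_imp_holomorphic_decomposition[of unit_disk u]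
      holomorphic_decomposition_imp_harmonic[of unit_disk _ _ u]
    by (metis convex_ball open_ball)
  thus ?thesis by (auto simp: harmonic_Bergman_def)
qed

lemma harmonic_Bergman_diff:
  assumes "u \<in> harmonic_Bergman" "v \<in> harmonic_Bergman"
  shows "(\<lambda>z. u z - v z) \<in> harmonic_Bergman"
proof -
  obtain F G where u: "F holomorphic_on unit_disk" "G holomorphic_on unit_disk"
    "\<And>z. z \<in> unit_disk \<Longrightarrow> u z = F z + cnj (G z)"
    using assms(1) unfolding harmonic_Bergman_iff by blast
  obtain F' G' where v: "F' holomorphic_on unit_disk" "G' holomorphic_on unit_disk"
    "\<And>z. z \<in> unit_disk \<Longrightarrow> v z = F' z + cnj (G' z)"
    using assms(2) unfolding harmonic_Bergman_iff by blast
  have "\<exists>F G. F holomorphic_on unit_disk \<and> G holomorphic_on unit_disk \<and>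
            (\<forall>z\<in>unit_disk. u z - v z = F z + cnj (G z))"
    using u v by (intro exI[of _ "\<lambda>z. F z - F' z"] exI[of _ "\<lambda>z. G z - G' z"])
      (auto intro!: holomorphic_intros)
  thus ?thesis using assms L2_diff unfolding harmonic_Bergman_iff by auto
qed

lemma harmonic_monomial_in_harmonic_Bergman:
  "(\<lambda>z. c * harmonic_monomial k z) \<in> harmonic_Bergman"
proof -
  have "(\<lambda>z. c * harmonic_monomial k z) \<in> L2 disk_measure"
    using measurable_harmonic_monomial mult_left_mono[OF cmod_harmonic_monomial_le_1]
    by (intro L2_bounded[of _ "cmod c * 1"]) (auto simp: norm_mult)
  moreover have "\<exists>F G. F holomorphic_on unit_disk \<and> G holomorphic_on unit_disk \<and>
            (\<forall>z\<in>unit_disk. c * harmonic_monomial k z = F z + cnj (G z))"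
  proof (cases "0 \<le> k")
    case True
    thus ?thesis
      by (intro exI[of _ "\<lambda>z. c * z ^ nat k"] exI[of _ "\<lambda>z. 0"])
        (auto simp: harmonic_monomial_def intro!: holomorphic_intros)
  next
    case False
    thus ?thesis
      by (intro exI[of _ "\<lambda>z. 0"] exI[of _ "\<lambda>z. cnj c * z ^ nat (- k)"])
        (auto simp: harmonic_monomial_def intro!: holomorphic_intros)
  qed
  ultimately show ?thesis unfolding harmonic_Bergman_iff by (auto simp: harmonic_monomial_def)
qed

text \<open>By continuity the set where \<open>u\<close> is nonzero is open, and a nonempty open set
  is not negligible. Outside the disk \<open>u\<close> vanishes by normalization.\<close>

lemma harmonic_Bergman_AE_0:
  assumes u: "u \<in> harmonic_Bergman" and ae: "AE z in disk_measure. u z = 0"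
  shows "u = (\<lambda>z. 0)"
proof (rule ext, rule ccontr)
  fix z0 assume z0: "u z0 \<noteq> 0"
  obtain F G where FG: "F holomorphic_on unit_disk" "G holomorphic_on unit_disk"
    "\<And>z. z \<in> unit_disk \<Longrightarrow> u z = F z + cnj (G z)"
    using u unfolding harmonic_Bergman_iff by blast
  have "continuous_on unit_disk (\<lambda>z. F z + cnj (G z))"
    using FG by (intro continuous_intros holomorphic_on_imp_continuous_on)
  hence c: "continuous_on unit_disk u"
    using FG(3) by (subst continuous_on_cong[OF refl]) auto
  define U where "U = {z \<in> unit_disk. u z \<noteq> 0}"
  have "U = u -` (- {0}) \<inter> unit_disk" by (auto simp: U_def)
  hence "open U" using continuous_on_open_vimage[of unit_disk u] c by (metis open_ball open_Compl closed_singleton)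
  moreover have "z0 \<in> U" using z0 u by (auto simp: U_def harmonic_Bergman_iff)
  moreover have "negligible U"
  proof -
    obtain N where N: "N \<in> null_sets disk_measure" "{z \<in> unit_disk. u z \<noteq> 0} \<subseteq> N"
    proof (rule AE_E[OF ae])
      fix N assume "{z \<in> space disk_measure. \<not> u z = 0} \<subseteq> N" "emeasure disk_measure N = 0" "N \<in> sets disk_measure"
      thus thesis by (intro that[of N]) auto
    qed
    hence "negligible N" by (simp add: null_sets_disk_measure negligible_iff_null_sets)
    thus ?thesis using N(2) unfolding U_def by (rule negligible_subset)
  qed
  ultimately show False using open_not_negligible by blast
qed

text \<open>The difference \<open>d\<close> of two candidates lies in the space and is orthogonal to
  it, hence to itself. A projection can therefore be computed by guessing its value.\<close>

lemma harmonic_proj_eqI: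
  assumes f: "f \<in> L2 disk_measure" and h: "h \<in> harmonic_Bergman"
    and orth: "\<And>u. u \<in> harmonic_Bergman \<Longrightarrow> L2_inner disk_measure (\<lambda>z. f z - h z) u = 0"
  shows "harmonic_proj f = h"
  unfolding harmonic_proj_def
proof (rule the_equality)
  fix h' assume h': "h' \<in> harmonic_Bergman \<and>
    (\<forall>u\<in>harmonic_Bergman. L2_inner disk_measure (\<lambda>z. f z - h' z) u = 0)"
  define d where "d = (\<lambda>z. h' z - h z)"
  have d: "d \<in> harmonic_Bergman" using h h' by (auto simp: d_def harmonic_Bergman_diff)
  have L: "d \<in> L2 disk_measure" "h \<in> L2 disk_measure" "h' \<in> L2 disk_measure"
    using h h' d unfolding harmonic_Bergman_iff by blast+
  have "L2_inner disk_measure (\<lambda>z. f z - h z) d - L2_inner disk_measure (\<lambda>z. f z - h' z) d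
      = (LINT z|disk_measure. (f z - h z) * cnj (d z) - (f z - h' z) * cnj (d z))"
    unfolding L2_inner_def
    by (intro Bochner_Integration.integral_diff[symmetric] L2_integrable_mult_cnj L2_diff f L)
  also have "\<dots> = (LINT z|disk_measure. of_real ((cmod (d z))\<^sup>2))"
  proof (intro Bochner_Integration.integral_cong refl)
    fix z
    have "(f z - h z) * cnj (d z) - (f z - h' z) * cnj (d z) = d z * cnj (d z)"
      by (simp add: d_def algebra_simps)
    thus "(f z - h z) * cnj (d z) - (f z - h' z) * cnj (d z) = of_real ((cmod (d z))\<^sup>2)"
      by (simp only: complex_norm_square)
  qed
  also have "\<dots> = of_real (LINT z|disk_measure. (cmod (d z))\<^sup>2)"
    by (rule integral_complex_of_real)
  finally have "(LINT z|disk_measure. (cmod (d z))\<^sup>2) = 0"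
    using orth[OF d] h' d by (simp del: of_real_eq_0_iff add: of_real_eq_0_iff[where 'a=complex, symmetric])
  hence "AE z in disk_measure. d z = 0"
    using L(1) by (subst (asm) integral_nonneg_eq_0_iff_AE) (auto simp: L2_iff)
  hence "d = (\<lambda>z. 0)" by (rule harmonic_Bergman_AE_0[OF d])
  thus "h' = h" by (auto simp: d_def fun_eq_iff)
qed (use h orth in auto)

subsection \<open>Toeplitz operators with quasihomogeneous symbols\<close>

text \<open>Angular frequency \<open>k\<close>. The origin is excluded because
  \<open>quasihomogeneous p \<phi>\<close> takes the value \<phi>(0) there, which the equation would
  force to be 0 for nonzero \<open>k\<close>.\<close>

definition disk_weight :: "int \<Rightarrow> (complex \<Rightarrow> complex) \<Rightarrow> bool" where
  "disk_weight k h \<longleftrightarrow> (\<forall>w z. cmod w = 1 \<longrightarrow> z \<in> unit_disk \<longrightarrow> z \<noteq> 0 \<longrightarrow> h (w * z) = w powi k * h z)"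

lemma measurable_disk_indicator_ball:
  "(indicator (ball 0 R) :: complex \<Rightarrow> complex) \<in> borel_measurable disk_measure"
  by (intro borel_imp_measurable_disk borel_measurable_indicator) simp

text \<open>The integrand has nonzero weight \<open>k - m\<close>, since the cutoff to a centred
  ball is invariant under rotation.\<close>

lemma disk_weight_integral_harmonic_monomial:
  assumes h: "h \<in> borel_measurable disk_measure" and w: "disk_weight k h" and m: "m \<noteq> k"
  shows "(LINT z|disk_measure. indicator (ball 0 R) z * h z * cnj (harmonic_monomial m z)) = 0"
proof (rule integral_disk_weight_eq_0)
  note [measurable] = h measurable_harmonic_monomial measurable_disk_indicator_ball[of R]
  show "(\<lambda>z. indicator (ball 0 R) z * h z * cnj (harmonic_monomial m z)) \<in> borel_measurable disk_measure"
    by measurable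
  show "k - m \<noteq> 0" using m by simp
  fix w z :: complex assume wz: "cmod w = 1" "z \<in> unit_disk" "z \<noteq> 0"
  have "h (w * z) = w powi k * h z" using w wz by (simp add: disk_weight_def)
  moreover have "indicator (ball 0 R) (w * z) = (indicator (ball 0 R) z :: complex)"
    using wz by (simp add: indicator_def norm_mult)
  ultimately show "indicator (ball 0 R) (w * z) * h (w * z) * cnj (harmonic_monomial m (w * z)) =
      w powi (k - m) * (indicator (ball 0 R) z * h z * cnj (harmonic_monomial m z))"
    using wz cnj_unit_powi[of w m k] by (simp add: harmonic_monomial_rotate mult_ac)
qed

lemma summable_power_of_smaller_radius:
  fixes a :: "nat \<Rightarrow> complex"
  assumes sums: "\<And>z. z \<in> unit_disk \<Longrightarrow> summable (\<lambda>m. a m * z ^ m)" and R: "0 < R" "R < 1"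
  shows "summable (\<lambda>m. cmod (a m) * R ^ m)"
proof -
  \<comment> \<open>Convergence at a point of larger modulus, here midway between \<open>R\<close>
    and 1, gives absolute convergence at \<open>R\<close>.\<close>
  have "summable (\<lambda>m. cmod (a m * of_real R ^ m))"
    by (rule powser_insidea[OF sums[of "of_real ((1 + R) / 2)"]]) (use R in \<open>auto simp del: of_real_divide of_real_add\<close>)
  thus ?thesis using R by (simp add: norm_mult norm_power)
qed

text \<open>Integrating the power series termwise over a smaller disk, only the term of weight \<open>k\<close> survives.\<close>

lemma disk_weight_integral_series:
  fixes \<iota> :: "nat \<Rightarrow> int"
  assumes h: "h \<in> borel_measurable disk_measure" and K: "\<And>z. z \<in> unit_disk \<Longrightarrow> cmod (h z) \<le> K"
    and w: "disk_weight k h"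
    and a: "\<And>R. 0 < R \<Longrightarrow> R < 1 \<Longrightarrow> summable (\<lambda>m. cmod (a m) * R ^ m)"
    and \<iota>: "inj \<iota>" "\<And>m. \<bar>\<iota> m\<bar> = int m"
    and v: "\<And>z. z \<in> unit_disk \<Longrightarrow> (\<lambda>m. a m * cnj (harmonic_monomial (\<iota> m) z)) sums v z"
  shows "\<exists>c. \<forall>R. 0 < R \<longrightarrow> R < 1 \<longrightarrow>
     integrable disk_measure (\<lambda>z. indicator (ball 0 R) z * h z * v z) \<and>
     (LINT z|disk_measure. indicator (ball 0 R) z * h z * v z) =
     c * (LINT z|disk_measure. indicator (ball 0 R) z * h z * cnj (harmonic_monomial k z))"
proof -
  \<comment> \<open>Since \<open>\<iota>\<close> is injective, at most one coefficient survives in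
    \<open>b\<close>. Its sum does not involve \<open>R\<close>, so a single constant
    \<open>c\<close> serves all radii.\<close>
  define b where "b = (\<lambda>m. if \<iota> m = k then a m else 0)"
  have "summable b"
  proof (rule summable_finite)
    show "finite (\<iota> -` {k})" using \<iota>(1) by (intro finite_vimageI) auto
  qed (auto simp: b_def)
  have K0: "0 \<le> K" using order_trans[OF norm_ge_zero K[of 0]] by simp
  show ?thesis
  proof (intro exI[of _ "suminf b"] allI impI)
    fix R :: real assume R: "0 < R" "R < 1"
    define J where "J = (LINT z|disk_measure. indicator (ball 0 R) z * h z * cnj (harmonic_monomial k z))"
    define f where "f = (\<lambda>m z. indicator (ball 0 R) z * h z * (a m * cnj (harmonic_monomial (\<iota> m) z)))"
    note [measurable] = h measurable_harmonic_monomial measurable_disk_indicator_ball[of R]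
    have fm [measurable]: "f m \<in> borel_measurable disk_measure" for m
      unfolding f_def by measurable
    \<comment> \<open>On the ball of radius \<open>R\<close> the monomial of index
      \<open>\<iota> m\<close> is at most \<open>R ^ m\<close>; this majorant justifies exchanging
      sum and integral.\<close>
    have fb: "cmod (f m z) \<le> K * (cmod (a m) * R ^ m)" if z: "z \<in> unit_disk" for m z
    proof (cases "z \<in> ball 0 R")
      case True
      hence "cmod (f m z) = cmod (h z) * (cmod (a m) * cmod z ^ m)"
        using z \<iota>(2)[of m] by (simp add: f_def norm_mult cmod_harmonic_monomial)
      also have "\<dots> \<le> K * (cmod (a m) * R ^ m)"
        using K[OF z] K0 True R by (intro mult_mono power_mono) auto
      finally show ?thesis .
    qed (use K0 R in \<open>simp add: f_def\<close>)
    have fi: "integrable disk_measure (f m)" for m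
      by (rule disk_integrable_bounded[OF fm fb])
    have sK: "summable (\<lambda>m. K * (cmod (a m) * R ^ m))"
      using a[OF R] by (rule summable_mult)
    have 1: "AE z in disk_measure. summable (\<lambda>m. norm (f m z))"
      by (rule AE_I2) (rule summable_comparison_test'[OF sK, of 0], use fb in simp)
    have "(LINT z|disk_measure. norm (f m z)) \<le> K * (cmod (a m) * R ^ m) * measure disk_measure unit_disk" for m
    proof -
      have "(LINT z|disk_measure. norm (f m z)) \<le> (LINT z|disk_measure. K * (cmod (a m) * R ^ m))"
        using fi fb by (intro integral_mono integrable_norm) auto
      thus ?thesis by (simp add: mult_ac)
    qed
    hence 2: "summable (\<lambda>m. LINT z|disk_measure. norm (f m z))"
      by (intro summable_comparison_test'[OF summable_mult2[OF sK, of "measure disk_measure unit_disk"], of 0])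
        (simp add: integral_nonneg_AE)
    have vs: "(\<Sum>m. f m z) = indicator (ball 0 R) z * h z * v z" if "z \<in> unit_disk" for z
      using sums_mult[OF v[OF that], of "indicator (ball 0 R) z * h z"]
      by (simp add: f_def sums_iff)
    have "integrable disk_measure (\<lambda>z. \<Sum>m. f m z)"
      by (rule integrable_suminf[OF fi 1 2])
    moreover have "integrable disk_measure (\<lambda>z. \<Sum>m. f m z) \<longleftrightarrow>
        integrable disk_measure (\<lambda>z. indicator (ball 0 R) z * h z * v z)"
      by (intro Bochner_Integration.integrable_cong) (simp_all add: vs)
    ultimately have i: "integrable disk_measure (\<lambda>z. indicator (ball 0 R) z * h z * v z)" by simp
    have "(\<lambda>m. LINT z|disk_measure. f m z) sums (LINT z|disk_measure. (\<Sum>m. f m z))"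
      by (rule sums_integral[OF fi 1 2])
    moreover have "(LINT z|disk_measure. (\<Sum>m. f m z)) = (LINT z|disk_measure. indicator (ball 0 R) z * h z * v z)"
      by (intro Bochner_Integration.integral_cong) (simp_all add: vs)
    moreover have "(LINT z|disk_measure. f m z) = b m * J" for m
    proof -
      have "(LINT z|disk_measure. f m z) =
          (LINT z|disk_measure. a m * (indicator (ball 0 R) z * h z * cnj (harmonic_monomial (\<iota> m) z)))"
        unfolding f_def by (intro Bochner_Integration.integral_cong) (simp_all add: mult_ac)
      also have "\<dots> = a m * (LINT z|disk_measure. indicator (ball 0 R) z * h z * cnj (harmonic_monomial (\<iota> m) z))"
        by (rule integral_mult_right_zero)
      also have "\<dots> = b m * J"
        using disk_weight_integral_harmonic_monomial[OF h w, of "\<iota> m" R] by (auto simp: b_def J_def)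
      finally show ?thesis .
    qed
    ultimately have "(\<lambda>m. b m * J) sums (LINT z|disk_measure. indicator (ball 0 R) z * h z * v z)"
      by simp
    moreover have "(\<lambda>m. b m * J) sums (suminf b * J)"
      using \<open>summable b\<close> by (intro sums_mult2 summable_sums)
    ultimately have "(LINT z|disk_measure. indicator (ball 0 R) z * h z * v z) = suminf b * J"
      by (rule sums_unique2)
    with i show "integrable disk_measure (\<lambda>z. indicator (ball 0 R) z * h z * v z) \<and>
      (LINT z|disk_measure. indicator (ball 0 R) z * h z * v z) =
      suminf b * (LINT z|disk_measure. indicator (ball 0 R) z * h z * cnj (harmonic_monomial k z))"
      by (simp add: J_def)
  qed
qed

lemma holomorphic_disk_coefficients:
  assumes "F holomorphic_on unit_disk"
  obtains a where "\<And>z. z \<in> unit_disk \<Longrightarrow> (\<lambda>m. a m * z ^ m) sums F z"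
    "\<And>R. 0 < R \<Longrightarrow> R < 1 \<Longrightarrow> summable (\<lambda>m. cmod (a m) * R ^ m)"
proof -
  define a where "a = (\<lambda>m. (deriv ^^ m) F 0 / fact m)"
  have "(\<lambda>m. a m * z ^ m) sums F z" if "z \<in> unit_disk" for z
    using holomorphic_power_series[OF assms that] by (simp add: a_def)
  moreover from this have "summable (\<lambda>m. cmod (a m) * R ^ m)" if "0 < R" "R < 1" for R
    using that by (intro summable_power_of_smaller_radius) (auto simp: sums_iff)
  ultimately show ?thesis by (rule that)
qed

text \<open>On a disk of radius \<open>R < 1\<close> both power series in
  \<open>u = F + cnj G\<close> can be integrated termwise, and each contributes a fixed multiple of
  \<open>J R\<close>. As \<open>R\<close> tends to 1, \<open>J R\<close> tends to the inner product
  with \<open>harmonic_monomial k\<close>, which is 0.\<close>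

lemma disk_weight_orthogonal_harmonic_Bergman:
  assumes h: "h \<in> borel_measurable disk_measure" and K: "\<And>z. z \<in> unit_disk \<Longrightarrow> cmod (h z) \<le> K"
    and w: "disk_weight k h"
    and orth: "(LINT z|disk_measure. h z * cnj (harmonic_monomial k z)) = 0"
    and u: "u \<in> harmonic_Bergman"
  shows "(LINT z|disk_measure. h z * cnj (u z)) = 0"
proof -
  obtain F G where F: "F holomorphic_on unit_disk" and G: "G holomorphic_on unit_disk"
    and FG: "\<And>z. z \<in> unit_disk \<Longrightarrow> u z = F z + cnj (G z)"
    using u unfolding harmonic_Bergman_iff by blast
  define J where "J = (\<lambda>R. LINT z|disk_measure. indicator (ball 0 R) z * h z * cnj (harmonic_monomial k z))"
  obtain f where f: "\<And>z. z \<in> unit_disk \<Longrightarrow> (\<lambda>m. f m * z ^ m) sums F z"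
    "\<And>R. 0 < R \<Longrightarrow> R < 1 \<Longrightarrow> summable (\<lambda>m. cmod (f m) * R ^ m)"
    using holomorphic_disk_coefficients[OF F] by blast
  have "\<exists>c. \<forall>R. 0 < R \<longrightarrow> R < 1 \<longrightarrow>
     integrable disk_measure (\<lambda>z. indicator (ball 0 R) z * h z * cnj (F z)) \<and>
     (LINT z|disk_measure. indicator (ball 0 R) z * h z * cnj (F z)) = c * J R"
    unfolding J_def
  proof (rule disk_weight_integral_series[OF h K w, where \<iota> = int and a = "\<lambda>m. cnj (f m)"])
    show "(\<lambda>m. cnj (f m) * cnj (harmonic_monomial (int m) z)) sums cnj (F z)" if "z \<in> unit_disk" for z
      using f(1)[OF that] that unfolding sums_cnj[symmetric, of _ "F z"] by (simp add: harmonic_monomial_def)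
  qed (use f(2) in auto)
  then obtain c where c: "\<And>R. 0 < R \<Longrightarrow> R < 1 \<Longrightarrow> integrable disk_measure (\<lambda>z. indicator (ball 0 R) z * h z * cnj (F z))"
    "\<And>R. 0 < R \<Longrightarrow> R < 1 \<Longrightarrow> (LINT z|disk_measure. indicator (ball 0 R) z * h z * cnj (F z)) = c * J R"
    by blast
  obtain g where g: "\<And>z. z \<in> unit_disk \<Longrightarrow> (\<lambda>m. g m * z ^ m) sums G z"
    "\<And>R. 0 < R \<Longrightarrow> R < 1 \<Longrightarrow> summable (\<lambda>m. cmod (g m) * R ^ m)"
    using holomorphic_disk_coefficients[OF G] by blast
  have "\<exists>c. \<forall>R. 0 < R \<longrightarrow> R < 1 \<longrightarrow>
     integrable disk_measure (\<lambda>z. indicator (ball 0 R) z * h z * G z) \<and>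
     (LINT z|disk_measure. indicator (ball 0 R) z * h z * G z) = c * J R"
    unfolding J_def
  proof (rule disk_weight_integral_series[OF h K w, where \<iota> = "\<lambda>m. - int m" and a = g])
    show "(\<lambda>m. g m * cnj (harmonic_monomial (- int m) z)) sums G z" if "z \<in> unit_disk" for z
    proof -
      \<comment> \<open>Conjugating \<open>u\<close> leaves \<open>G\<close> unconjugated, and its
        powers are the conjugates of the monomials with index at most 0.\<close>
      have "cnj (harmonic_monomial (- int m) z) = z ^ m" for m
        using that by (cases "m = 0") (auto simp: harmonic_monomial_def)
      thus ?thesis using g(1)[OF that] by simp
    qed
  qed (use g(2) in \<open>auto simp: inj_def\<close>)
  then obtain d where d: "\<And>R. 0 < R \<Longrightarrow> R < 1 \<Longrightarrow> integrable disk_measure (\<lambda>z. indicator (ball 0 R) z * h z * G z)"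
    "\<And>R. 0 < R \<Longrightarrow> R < 1 \<Longrightarrow> (LINT z|disk_measure. indicator (ball 0 R) z * h z * G z) = d * J R"
    by blast
  have cd: "(LINT z|disk_measure. indicator (ball 0 R) z * h z * cnj (u z)) = (c + d) * J R" if R: "0 < R" "R < 1" for R
  proof -
    have "(LINT z|disk_measure. indicator (ball 0 R) z * h z * cnj (u z)) =
      (LINT z|disk_measure. indicator (ball 0 R) z * h z * cnj (F z) + indicator (ball 0 R) z * h z * G z)"
      by (intro Bochner_Integration.integral_cong) (simp_all add: FG algebra_simps)
    also have "\<dots> = c * J R + d * J R"
      using c[OF R] d[OF R] by (simp add: Bochner_Integration.integral_add)
    finally show ?thesis by (simp add: algebra_simps)
  qed
  \<comment> \<open>The shift by 2 keeps the first radius positive, namely 1/2.\<close>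
  define r where "r = (\<lambda>n::nat. 1 - inverse (real (n + 2)))"
  have r: "0 < r n" "r n < 1" for n by (auto simp: r_def inverse_eq_divide)
  have r1: "r \<longlonglongrightarrow> 1"
    unfolding r_def using tendsto_diff[OF tendsto_const[of 1] LIMSEQ_Suc[OF LIMSEQ_inverse_real_of_nat]]
    by simp
  have lim: "(\<lambda>n. LINT z|disk_measure. indicator (ball 0 (r n)) z * h z * cnj (v z)) \<longlonglongrightarrow>
      (LINT z|disk_measure. h z * cnj (v z))" if v: "v \<in> L2 disk_measure" for v
  proof (rule integral_dominated_convergence)
    note [measurable] = h v[unfolded L2_iff, THEN conjunct1] measurable_disk_indicator_ball
    show "(\<lambda>z. h z * cnj (v z)) \<in> borel_measurable disk_measure" by measurable
    show "(\<lambda>z. indicator (ball 0 (r n)) z * h z * cnj (v z)) \<in> borel_measurable disk_measure" for n by measurable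
    show "integrable disk_measure (\<lambda>z. cmod (h z * cnj (v z)))"
      by (intro integrable_norm L2_integrable_mult_cnj v L2_bounded[OF h K])
    show "AE z in disk_measure. (\<lambda>n. indicator (ball 0 (r n)) z * h z * cnj (v z)) \<longlonglongrightarrow> h z * cnj (v z)"
    proof (rule AE_I2)
      fix z assume z: "z \<in> space disk_measure"
      have "eventually (\<lambda>n. cmod z < r n) sequentially"
        using order_tendstoD(1)[OF r1, of "cmod z"] z by simp
      hence "eventually (\<lambda>n. indicator (ball 0 (r n)) z * h z * cnj (v z) = h z * cnj (v z)) sequentially"
        by eventually_elim (simp add: indicator_def)
      thus "(\<lambda>n. indicator (ball 0 (r n)) z * h z * cnj (v z)) \<longlonglongrightarrow> h z * cnj (v z)"
        by (rule tendsto_eventually)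
    qed
    show "AE z in disk_measure. cmod (indicator (ball 0 (r n)) z * h z * cnj (v z)) \<le> cmod (h z * cnj (v z))" for n
      by (intro AE_I2) (simp add: indicator_def)
  qed
  have "u \<in> L2 disk_measure" using u by (simp add: harmonic_Bergman_iff)
  from lim[OF this] have "(\<lambda>n. (c + d) * J (r n)) \<longlonglongrightarrow> (LINT z|disk_measure. h z * cnj (u z))"
    using r by (simp add: cd)
  moreover have "(\<lambda>n. J (r n)) \<longlonglongrightarrow> 0"
    unfolding J_def using lim[of "harmonic_monomial k"] orth
      L2_bounded[OF measurable_harmonic_monomial cmod_harmonic_monomial_le_1] by simp
  hence "(\<lambda>n. (c + d) * J (r n)) \<longlonglongrightarrow> (c + d) * 0" by (intro tendsto_mult tendsto_const)
  ultimately show ?thesis using LIMSEQ_unique by fastforce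
qed

lemma quasihomogeneous_eq:
  assumes "radial \<phi>" "z \<in> unit_disk"
  shows "quasihomogeneous p \<phi> z = cis (of_int p * Arg z) * \<phi> z"
proof -
  have "of_real (cmod z) \<in> unit_disk" using assms(2) by simp
  hence "\<phi> (of_real (cmod z)) = \<phi> z" using assms unfolding radial_def by (metis norm_of_real abs_norm_cancel)
  thus ?thesis by (simp add: quasihomogeneous_def)
qed

text \<open>The power of \<open>sgn z\<close> is measurable and multiplicative, whereas
  \<open>Arg\<close> has a branch cut.\<close>

lemma cis_of_int_Arg: "cis (of_int p * Arg z) = (if z = 0 then 1 else sgn z powi p)"
proof (cases "z = 0")
  case False
  thus ?thesis by (simp add: cis_power_int[symmetric] cis_Arg)
qed (simp add: Arg_zero)

lemma measurable_quasihomogeneous: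
  assumes "radial \<phi>" "\<phi> \<in> borel_measurable disk_measure"
  shows "quasihomogeneous p \<phi> \<in> borel_measurable disk_measure"
proof -
  note [measurable] = assms(2)
  have "(\<lambda>z::complex. if z = 0 then 1 else sgn z powi p) \<in> borel_measurable borel"
    unfolding power_int_def by measurable
  note [measurable] = borel_imp_measurable_disk[OF this]
  have "(\<lambda>z. (if z = 0 then 1 else sgn z powi p) * \<phi> z) \<in> borel_measurable disk_measure"
    by measurable
  thus ?thesis
    by (subst measurable_cong[where g = "\<lambda>z. (if z = 0 then 1 else sgn z powi p) * \<phi> z"])
      (simp_all add: quasihomogeneous_eq[OF assms(1)] cis_of_int_Arg)
qed

lemma disk_weight_quasihomogeneous:
  assumes "radial \<phi>"
  shows "disk_weight p (quasihomogeneous p \<phi>)"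
  unfolding disk_weight_def
proof (intro allI impI)
  fix w z :: complex assume wz: "cmod w = 1" "z \<in> unit_disk" "z \<noteq> 0"
  have "sgn w = w" using wz(1) by (simp add: sgn_eq)
  hence "sgn (w * z) = w * sgn z" by (simp add: sgn_mult)
  moreover have "w * z \<noteq> 0" using wz by auto
  ultimately show "quasihomogeneous p \<phi> (w * z) = w powi p * quasihomogeneous p \<phi> z"
    using wz by (simp add: quasihomogeneous_def cis_of_int_Arg norm_mult power_int_mult_distrib)
qed

lemma disk_weight_harmonic_monomial: "disk_weight k (harmonic_monomial k)"
  by (simp add: disk_weight_def harmonic_monomial_rotate)

lemma disk_weight_mult:
  assumes "disk_weight k f" "disk_weight l g"
  shows "disk_weight (k + l) (\<lambda>z. f z * g z)"
  unfolding disk_weight_def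
proof (intro allI impI)
  fix w z :: complex assume wz: "cmod w = 1" "z \<in> unit_disk" "z \<noteq> 0"
  hence "w \<noteq> 0" by auto
  thus "f (w * z) * g (w * z) = w powi (k + l) * (f z * g z)"
    using assms wz by (simp add: disk_weight_def power_int_add)
qed

section \<open>The action of quasihomogeneous Toeplitz operators on monomials\<close>

definition monomial_norm2 :: "int \<Rightarrow> complex" where
  "monomial_norm2 k = (LINT z|disk_measure. harmonic_monomial k z * cnj (harmonic_monomial k z))"

lemma monomial_norm2_nonzero: "monomial_norm2 k \<noteq> 0"
proof
  assume "monomial_norm2 k = 0"
  moreover have "monomial_norm2 k = of_real (LINT z|disk_measure. (cmod (harmonic_monomial k z))\<^sup>2)"
    unfolding monomial_norm2_def complex_norm_square[symmetric] by (rule integral_complex_of_real)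
  ultimately have "(LINT z|disk_measure. (cmod (harmonic_monomial k z))\<^sup>2) = 0"
    by (simp only: of_real_eq_0_iff)
  moreover have hb: "harmonic_monomial k \<in> harmonic_Bergman"
    using harmonic_monomial_in_harmonic_Bergman[of 1 k] by simp
  hence "harmonic_monomial k \<in> L2 disk_measure" by (simp add: harmonic_Bergman_iff)
  ultimately have "AE z in disk_measure. harmonic_monomial k z = 0"
    by (subst (asm) integral_nonneg_eq_0_iff_AE) (auto simp: L2_iff)
  hence "harmonic_monomial k = (\<lambda>z. 0)" by (rule harmonic_Bergman_AE_0[OF hb])
  moreover have "cmod (harmonic_monomial k (1/2)) \<noteq> 0" by (subst cmod_harmonic_monomial) auto
  ultimately show False by simp
qed

text \<open>The product \<open>f\<close> of symbol and monomial has weight \<open>n + p\<close>.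
  Subtracting the multiple \<open>lam\<close> of the monomial of that index makes it orthogonal to
  this monomial, and by its weight to the whole space. The scalar \<open>c\<close> allows two
  operators to be composed; \<open>pos\<close> excludes exponent 0, where
  \<open>radial_power\<close> differs from the ordinary power at the origin.\<close>

lemma Toeplitz_harmonic_monomial:
  assumes m: "\<phi> \<in> borel_measurable disk_measure" and K: "\<And>z. z \<in> unit_disk \<Longrightarrow> cmod (\<phi> z) \<le> K"
    and rad: "radial \<phi>" and pos: "0 < \<bar>n\<bar> + \<bar>n + p\<bar>"
  shows "Toeplitz (quasihomogeneous p \<phi>) (\<lambda>z. c * harmonic_monomial n z) =
    (\<lambda>z. c * (Mellin \<phi> (of_int (\<bar>n\<bar> + \<bar>n + p\<bar>)) / monomial_norm2 (n + p)) * harmonic_monomial (n + p) z)"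
proof -
  define I where "I = Mellin \<phi> (of_int (\<bar>n\<bar> + \<bar>n + p\<bar>))"
  define lam where "lam = I / monomial_norm2 (n + p)"
  define f where "f = (\<lambda>z. quasihomogeneous p \<phi> z * harmonic_monomial n z)"
  define h where "h = (\<lambda>z. f z - lam * harmonic_monomial (n + p) z)"
  have K0: "0 \<le> K" using order_trans[OF norm_ge_zero K[of 0]] by simp
  note [measurable] = measurable_quasihomogeneous[OF rad m, of p] measurable_harmonic_monomial
  have fm: "f \<in> borel_measurable disk_measure" unfolding f_def by measurable
  have hm: "h \<in> borel_measurable disk_measure" unfolding h_def f_def by measurable
  have fK: "cmod (f z) \<le> K * 1" if "z \<in> unit_disk" for z
    using K that K0 cmod_harmonic_monomial_le_1[OF that, of n]
    unfolding f_def norm_mult quasihomogeneous_eq[OF rad that] by (intro mult_mono) auto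
  have hK: "cmod (h z) \<le> K * 1 + cmod lam * 1" if "z \<in> unit_disk" for z
    unfolding h_def using fK[OF that] mult_left_mono[OF cmod_harmonic_monomial_le_1[OF that, of "n + p"], of "cmod lam"]
    by (intro order_trans[OF norm_triangle_ineq4]) (auto simp: norm_mult)
  have "disk_weight (n + p) f"
    using disk_weight_mult[OF disk_weight_quasihomogeneous[OF rad, of p] disk_weight_harmonic_monomial[of n]]
    by (simp add: f_def add.commute)
  hence hw: "disk_weight (n + p) h"
    by (simp add: disk_weight_def h_def harmonic_monomial_rotate algebra_simps)
  have ip: "integrable disk_measure (\<lambda>z. g z * cnj (harmonic_monomial (n + p) z))"
    if "g \<in> borel_measurable disk_measure" "\<And>z. z \<in> unit_disk \<Longrightarrow> cmod (g z) \<le> L" for g L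
    using that by (intro L2_integrable_mult_cnj L2_bounded[of g] L2_bounded[OF measurable_harmonic_monomial cmod_harmonic_monomial_le_1])
  \<comment> \<open>The angular factors cancel, so only the powers of the modulus and the radial
    function remain under the integral.\<close>
  have fI: "(LINT z|disk_measure. f z * cnj (harmonic_monomial (n + p) z)) = I"
    unfolding I_def Mellin_def
  proof (rule Bochner_Integration.integral_cong[OF refl])
    fix z assume "z \<in> space disk_measure"
    hence z: "z \<in> unit_disk" by simp
    have e: "nat \<bar>n\<bar> + nat \<bar>n + p\<bar> = nat (\<bar>n\<bar> + \<bar>n + p\<bar>)" by (simp add: nat_add_distrib)
    have "cis (of_int p * Arg z) * cis (of_int n * Arg z) * cnj (cis (of_int (n + p) * Arg z)) = 1"
      by (simp add: cis_cnj cis_mult algebra_simps)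
    hence "f z * cnj (harmonic_monomial (n + p) z) = \<phi> z * of_real (cmod z ^ nat \<bar>n\<bar>) * of_real (cmod z ^ nat \<bar>n + p\<bar>)"
      unfolding f_def harmonic_monomial_polar[OF z] quasihomogeneous_eq[OF rad z]
      by (simp add: mult_ac)
    also have "\<dots> = \<phi> z * of_real (cmod z ^ nat (\<bar>n\<bar> + \<bar>n + p\<bar>))"
      by (simp add: power_add mult.assoc flip: e)
    also have "\<dots> = \<phi> z * radial_power (of_nat (nat (\<bar>n\<bar> + \<bar>n + p\<bar>))) z"
      using pos by (subst radial_power_of_nat) auto
    finally show "f z * cnj (harmonic_monomial (n + p) z) = \<phi> z * radial_power (of_int (\<bar>n\<bar> + \<bar>n + p\<bar>)) z"
      using pos by (simp only: of_nat_nat order_less_imp_le)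
  qed
  have "(LINT z|disk_measure. h z * cnj (harmonic_monomial (n + p) z)) =
    (LINT z|disk_measure. f z * cnj (harmonic_monomial (n + p) z)
       - lam * (harmonic_monomial (n + p) z * cnj (harmonic_monomial (n + p) z)))"
    by (simp add: h_def algebra_simps)
  also have "\<dots> = I - lam * monomial_norm2 (n + p)"
    using ip[OF fm fK] ip[OF measurable_harmonic_monomial cmod_harmonic_monomial_le_1]
    by (simp add: fI monomial_norm2_def)
  also have "\<dots> = 0" using monomial_norm2_nonzero by (simp add: lam_def)
  finally have orth: "(LINT z|disk_measure. h z * cnj (harmonic_monomial (n + p) z)) = 0" .
  have "harmonic_proj (\<lambda>z. c * f z) = (\<lambda>z. c * lam * harmonic_monomial (n + p) z)"
  proof (rule harmonic_proj_eqI[OF _ harmonic_monomial_in_harmonic_Bergman])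
    show "(\<lambda>z. c * f z) \<in> L2 disk_measure"
      using fm mult_left_mono[OF fK, of _ "cmod c"] by (intro L2_bounded[of _ "cmod c * (K * 1)"]) (auto simp: norm_mult)
    fix u assume u: "u \<in> harmonic_Bergman"
    have "L2_inner disk_measure (\<lambda>z. c * f z - c * lam * harmonic_monomial (n + p) z) u =
        (LINT z|disk_measure. c * (h z * cnj (u z)))"
      unfolding L2_inner_def h_def by (intro Bochner_Integration.integral_cong) (auto simp: algebra_simps)
    also have "\<dots> = 0"
      using disk_weight_orthogonal_harmonic_Bergman[OF hm hK hw orth u] by simp
    finally show "L2_inner disk_measure (\<lambda>z. c * f z - c * lam * harmonic_monomial (n + p) z) u = 0" .
  qed
  moreover have "Toeplitz (quasihomogeneous p \<phi>) (\<lambda>z. c * harmonic_monomial n z) = harmonic_proj (\<lambda>z. c * f z)"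
    by (simp add: Toeplitz_def f_def mult.left_commute)
  ultimately show ?thesis by (simp add: lam_def I_def)
qed

subsection \<open>Functions with vanishing moments\<close>

text \<open>Bounded functions orthogonal to all polynomials in \<open>z\<close> and
  \<open>cnj z\<close>. Boundedness supplies the integrability that makes the class closed under
  sums and under multiplication by polynomials.\<close>

definition moment_free :: "(complex \<Rightarrow> complex) \<Rightarrow> bool" where
  "moment_free h \<longleftrightarrow> h \<in> borel_measurable disk_measure \<and>
     (\<exists>K. \<forall>z\<in>unit_disk. cmod (h z) \<le> K) \<and>
     (\<forall>a b. (LINT z|disk_measure. h z * (z ^ a * cnj z ^ b)) = 0)"

lemma measurable_disk_ident: "(\<lambda>z. z) \<in> borel_measurable disk_measure"
  by (rule borel_imp_measurable_disk) simp

lemma moment_free_integrable: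
  assumes "moment_free h"
  shows "integrable disk_measure (\<lambda>z. h z * (z ^ a * cnj z ^ b))"
proof -
  obtain K where K: "\<And>z. z \<in> unit_disk \<Longrightarrow> cmod (h z) \<le> K"
    using assms unfolding moment_free_def by blast
  have [measurable]: "h \<in> borel_measurable disk_measure"
    using assms by (simp add: moment_free_def)
  note [measurable] = measurable_disk_ident
  show ?thesis
  proof (rule disk_integrable_bounded[of _ K])
    fix z assume z: "z \<in> unit_disk"
    have "cmod (h z * (z ^ a * cnj z ^ b)) \<le> K * (1 * 1)"
      unfolding norm_mult norm_power complex_mod_cnj using K[OF z] z order_trans[OF norm_ge_zero K[OF z]]
      by (intro mult_mono power_le_one) auto
    thus "cmod (h z * (z ^ a * cnj z ^ b)) \<le> K" by simp
  qed measurable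
qed

lemma moment_free_add:
  assumes f: "moment_free f" and g: "moment_free g"
  shows "moment_free (\<lambda>z. f z + g z)"
  unfolding moment_free_def
proof (intro conjI allI)
  show "(\<lambda>z. f z + g z) \<in> borel_measurable disk_measure"
    using f g by (auto simp: moment_free_def)
  obtain K L where "\<And>z. z \<in> unit_disk \<Longrightarrow> cmod (f z) \<le> K" "\<And>z. z \<in> unit_disk \<Longrightarrow> cmod (g z) \<le> L"
    using f g unfolding moment_free_def by blast
  thus "\<exists>K. \<forall>z\<in>unit_disk. cmod (f z + g z) \<le> K"
    by (intro exI[of _ "K + L"]) (auto intro!: norm_triangle_le add_mono)
  show "(LINT z|disk_measure. (f z + g z) * (z ^ a * cnj z ^ b)) = 0" for a b
    using moment_free_integrable[OF f, of a b] moment_free_integrable[OF g, of a b] f g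
    by (simp add: moment_free_def distrib_right)
qed

lemma moment_free_cmult:
  assumes f: "moment_free f"
  shows "moment_free (\<lambda>z. c * f z)"
  unfolding moment_free_def
proof (intro conjI allI)
  show "(\<lambda>z. c * f z) \<in> borel_measurable disk_measure"
    using f by (auto simp: moment_free_def)
  obtain K where "\<And>z. z \<in> unit_disk \<Longrightarrow> cmod (f z) \<le> K"
    using f unfolding moment_free_def by blast
  thus "\<exists>K. \<forall>z\<in>unit_disk. cmod (c * f z) \<le> K"
    by (intro exI[of _ "cmod c * K"]) (auto simp: norm_mult intro!: mult_left_mono)
  show "(LINT z|disk_measure. (c * f z) * (z ^ a * cnj z ^ b)) = 0" for a b
    using f by (simp add: moment_free_def mult.assoc)
qed

lemma moment_free_monomial:
  assumes f: "moment_free f"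
  shows "moment_free (\<lambda>z. f z * (z ^ m * cnj z ^ n))"
  unfolding moment_free_def
proof (intro conjI allI)
  have [measurable]: "f \<in> borel_measurable disk_measure" using f by (simp add: moment_free_def)
  note [measurable] = measurable_disk_ident
  show "(\<lambda>z. f z * (z ^ m * cnj z ^ n)) \<in> borel_measurable disk_measure" by measurable
  obtain K where K: "\<And>z. z \<in> unit_disk \<Longrightarrow> cmod (f z) \<le> K"
    using f unfolding moment_free_def by blast
  have "cmod (f z * (z ^ m * cnj z ^ n)) \<le> K * (1 * 1)" if z: "z \<in> unit_disk" for z
    unfolding norm_mult norm_power complex_mod_cnj using K[OF z] z order_trans[OF norm_ge_zero K[OF z]]
    by (intro mult_mono power_le_one) auto
  thus "\<exists>K. \<forall>z\<in>unit_disk. cmod (f z * (z ^ m * cnj z ^ n)) \<le> K" by blast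
  show "(LINT z|disk_measure. f z * (z ^ m * cnj z ^ n) * (z ^ a * cnj z ^ b)) = 0" for a b
  proof -
    have "f z * (z ^ m * cnj z ^ n) * (z ^ a * cnj z ^ b) = f z * (z ^ (m + a) * cnj z ^ (n + b))" for z
      by (simp only: power_add mult_ac)
    thus ?thesis using f unfolding moment_free_def by presburger
  qed
qed

lemma moment_free_real_polynomial:
  assumes "real_polynomial_function p" "moment_free h"
  shows "moment_free (\<lambda>z. h z * of_real (p z))"
  using assms
\<comment> \<open>The function \<open>h\<close> must vary: in the product case the second factor is
  applied to \<open>h\<close> already multiplied by the first.\<close>
proof (induction p arbitrary: h rule: real_polynomial_function.induct)
  case (linear f)
  interpret bounded_linear f by fact
  \<comment> \<open>The coefficients come from substituting \<open>Re z = (z + cnj z) / 2\<close>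
    and \<open>Im z = (z - cnj z) / (2 * \<i>)\<close> in the real linear form.\<close>
  define \<alpha> where "\<alpha> = (of_real (f 1) - \<i> * of_real (f \<i>)) / 2"
  define \<beta> where "\<beta> = (of_real (f 1) + \<i> * of_real (f \<i>)) / 2"
  have "complex_of_real (f z) = \<alpha> * z + \<beta> * cnj z" for z
  proof -
    have "z = Re z *\<^sub>R 1 + Im z *\<^sub>R \<i>" by (simp add: complex_eq_iff)
    hence "f z = f (Re z *\<^sub>R 1 + Im z *\<^sub>R \<i>)" by simp
    hence "f z = Re z * f 1 + Im z * f \<i>" by (simp only: add scaleR real_scaleR_def)
    thus ?thesis by (simp add: \<alpha>_def \<beta>_def complex_eq_iff field_simps)
  qed
  hence "h z * of_real (f z) = \<alpha> * (h z * (z ^ 1 * cnj z ^ 0)) + \<beta> * (h z * (z ^ 0 * cnj z ^ 1))" for z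
    by (simp add: algebra_simps)
  thus ?case using linear.prems by (simp only:) (intro moment_free_add moment_free_cmult moment_free_monomial)
next
  case (const c)
  thus ?case using moment_free_cmult[of h "of_real c"] by (simp add: mult.commute)
next
  case (add f g)
  thus ?case using moment_free_add[OF add.IH(1) add.IH(2)] by (simp add: algebra_simps)
next
  case (mult f g)
  show ?case using mult.IH(2)[OF mult.IH(1)[OF mult.prems]] by (simp add: mult.assoc)
qed

lemma moment_free_polynomial:
  assumes p: "polynomial_function (p :: complex \<Rightarrow> complex)" and h: "moment_free h"
  shows "moment_free (\<lambda>z. h z * p z)"
proof -
  have "real_polynomial_function (Re \<circ> p)" "real_polynomial_function (Im \<circ> p)"
    using p bounded_linear_Re bounded_linear_Im unfolding polynomial_function_def by blast+
  note m = this[THEN moment_free_real_polynomial, OF h]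
  have "h z * p z = h z * of_real ((Re \<circ> p) z) + \<i> * (h z * of_real ((Im \<circ> p) z))" for z
    by (subst complex_eq[of "p z"]) (simp add: algebra_simps)
  thus ?thesis using moment_free_add[OF m(1) moment_free_cmult[OF m(2), of \<i>]] by simp
qed

text \<open>By Stone-Weierstrass, \<open>g\<close> is within \<open>e\<close> of a polynomial on the
  closed disk. The polynomial contributes nothing, so the integral is at most \<open>e * L\<close>
  for every positive \<open>e\<close>.\<close>

lemma moment_free_continuous:
  assumes h: "moment_free h" and g: "continuous_on UNIV (g :: complex \<Rightarrow> complex)"
  shows "(LINT z|disk_measure. h z * g z) = 0"
proof -
  obtain K where K: "\<And>z. z \<in> unit_disk \<Longrightarrow> cmod (h z) \<le> K"
    using h unfolding moment_free_def by blast
  have K0: "0 \<le> K" using order_trans[OF norm_ge_zero K[of 0]] by simp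
  have [measurable]: "h \<in> borel_measurable disk_measure" using h by (simp add: moment_free_def)
  have [measurable]: "g \<in> borel_measurable disk_measure"
    using g by (intro continuous_imp_measurable_disk) (rule continuous_on_subset, auto)
  define L where "L = K * measure disk_measure unit_disk"
  have le: "cmod (LINT z|disk_measure. h z * g z) \<le> e * L" if e: "e > 0" for e
  proof -
    have "\<exists>p. polynomial_function p \<and> (\<forall>z\<in>cball 0 1. cmod (g z - p z) < e)"
      by (rule Stone_Weierstrass_polynomial_function[OF compact_cball continuous_on_subset[OF g subset_UNIV] e])
    then obtain p where p: "polynomial_function p" "\<And>z. z \<in> cball 0 1 \<Longrightarrow> cmod (g z - p z) < e"
      by blast
    have [measurable]: "p \<in> borel_measurable disk_measure"
      using p(1) by (intro continuous_imp_measurable_disk continuous_on_polymonial_function)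
    have m: "moment_free (\<lambda>z. h z * p z)" by (rule moment_free_polynomial[OF p(1) h])
    have b: "cmod (h z * (g z - p z)) \<le> K * e" if "z \<in> unit_disk" for z
      unfolding norm_mult using K[OF that] K0 p(2)[of z] that by (intro mult_mono) auto
    have "(LINT z|disk_measure. h z * g z) = (LINT z|disk_measure. h z * (g z - p z) + h z * p z)"
      by (simp add: algebra_simps)
    also have "\<dots> = (LINT z|disk_measure. h z * (g z - p z)) + (LINT z|disk_measure. h z * p z)"
    proof (rule Bochner_Integration.integral_add)
      show "integrable disk_measure (\<lambda>z. h z * (g z - p z))"
        by (rule disk_integrable_bounded[OF _ b]) measurable
      show "integrable disk_measure (\<lambda>z. h z * p z)"
        using moment_free_integrable[OF m, of 0 0] by simp
    qed
    also have "(LINT z|disk_measure. h z * p z) = 0"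
    proof -
      have "(LINT z|disk_measure. h z * p z * (z ^ 0 * cnj z ^ 0)) = 0"
        using m unfolding moment_free_def by blast
      thus ?thesis by simp
    qed
    finally have "(LINT z|disk_measure. h z * g z) = (LINT z|disk_measure. h z * (g z - p z))" by simp
    moreover have "cmod (LINT z|disk_measure. h z * (g z - p z)) \<le> K * e * measure disk_measure unit_disk"
      by (rule disk_integral_bound[OF _ b]) measurable
    ultimately show ?thesis by (simp add: L_def mult_ac)
  qed
  have "((\<lambda>e. e * L) \<longlongrightarrow> 0 * L) (at_right 0)"
    by (intro tendsto_mult tendsto_const tendsto_ident_at)
  moreover have "eventually (\<lambda>e. cmod (LINT z|disk_measure. h z * g z) \<le> e * L) (at_right 0)"
    using eventually_at_right_less by eventually_elim (rule le)
  ultimately have "cmod (LINT z|disk_measure. h z * g z) \<le> 0 * L"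
    by (intro tendsto_lowerbound) auto
  thus ?thesis by simp
qed

text \<open>A measurable function is an almost everywhere limit of continuous ones, so \<open>h\<close> is
  orthogonal to itself.\<close>

lemma moment_free_AE_0:
  assumes h: "moment_free h"
  shows "AE z in disk_measure. h z = 0"
proof -
  obtain K where K: "\<And>z. z \<in> unit_disk \<Longrightarrow> cmod (h z) \<le> K"
    using h unfolding moment_free_def by blast
  have K0: "0 \<le> K" using order_trans[OF norm_ge_zero K[of 0]] by simp
  have hm [measurable]: "h \<in> borel_measurable disk_measure" using h by (simp add: moment_free_def)
  have "(\<lambda>z. cnj (h z)) measurable_on unit_disk"
    using borel_measurable_cnj[OF hm]
    by (subst measurable_on_iff_borel_measurable) (auto simp: measurable_disk_measure_eq)
  then obtain N g where N: "negligible N" and g: "\<And>n. continuous_on UNIV (g n :: complex \<Rightarrow> complex)"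
    and lim: "\<And>z. z \<notin> N \<Longrightarrow> (\<lambda>n. g n z) \<longlonglongrightarrow> (if z \<in> unit_disk then cnj (h z) else 0)"
    unfolding measurable_on_def by blast
  \<comment> \<open>The approximants \<open>g n\<close> carry no common bound. The nearest-point map
    onto the ball of radius \<open>K\<close> is continuous, fixes the values of
    \<open>cnj (h z)\<close>, and yields the bound for dominated convergence.\<close>
  define T where "T = closest_point (cball (0::complex) K)"
  have T: "continuous_on UNIV T"
    unfolding T_def using K0 by (intro continuous_on_closest_point) auto
  have TK: "cmod (T w) \<le> K" for w
    using closest_point_in_set[of "cball (0::complex) K" w] K0 by (simp add: T_def)
  have Tid: "T w = w" if "cmod w \<le> K" for w
    unfolding T_def using that by (intro closest_point_self) simp
  have Tg: "continuous_on UNIV (\<lambda>z. T (g n z))" for n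
    using continuous_on_compose2[OF T g] by simp
  have [measurable]: "(\<lambda>z. T (g n z)) \<in> borel_measurable disk_measure" for n
    using Tg by (intro continuous_imp_measurable_disk) (rule continuous_on_subset, auto)
  have "AE z in disk_measure. z \<notin> N"
  proof (rule AE_I')
    show "N \<inter> unit_disk \<in> null_sets disk_measure"
      using negligible_Int[of N unit_disk] N by (simp add: null_sets_disk_measure negligible_iff_null_sets)
  qed auto
  hence ae: "AE z in disk_measure. (\<lambda>n. h z * T (g n z)) \<longlonglongrightarrow> h z * cnj (h z)"
    using AE_space
  proof eventually_elim
    case (elim z)
    hence "(\<lambda>n. g n z) \<longlonglongrightarrow> cnj (h z)" using lim[of z] by simp
    hence "(\<lambda>n. T (g n z)) \<longlonglongrightarrow> T (cnj (h z))"
      using T by (intro continuous_on_tendsto_compose[OF T]) auto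
    moreover have "T (cnj (h z)) = cnj (h z)" using K[of z] elim by (intro Tid) simp
    ultimately show ?case by (intro tendsto_mult) auto
  qed
  have "(\<lambda>n. LINT z|disk_measure. h z * T (g n z)) \<longlonglongrightarrow> (LINT z|disk_measure. h z * cnj (h z))"
  proof (rule integral_dominated_convergence[OF _ _ _ ae])
    show "integrable disk_measure (\<lambda>z. K * K)" by simp
    show "AE z in disk_measure. cmod (h z * T (g n z)) \<le> K * K" for n
      using K TK K0 by (intro AE_I2) (auto simp: norm_mult intro!: mult_mono)
  qed measurable
  hence "(LINT z|disk_measure. h z * cnj (h z)) = 0"
    using moment_free_continuous[OF h Tg] LIMSEQ_unique[OF tendsto_const] by fastforce
  moreover have "(LINT z|disk_measure. h z * cnj (h z)) = of_real (LINT z|disk_measure. (cmod (h z))\<^sup>2)"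
    unfolding complex_norm_square[symmetric] by (rule integral_complex_of_real)
  ultimately have "(LINT z|disk_measure. (cmod (h z))\<^sup>2) = 0"
    by (simp only: of_real_eq_0_iff)
  moreover have "h \<in> L2 disk_measure" by (rule L2_bounded[OF hm K])
  ultimately show ?thesis
    by (subst (asm) integral_nonneg_eq_0_iff_AE) (auto simp: L2_iff)
qed

text \<open>After multiplication by the squared modulus, moments with \<open>a \<noteq> b\<close>
  vanish by rotation, and those with \<open>a = b\<close> are values of the Mellin transform at
  \<open>2 * (a + 1)\<close>.\<close>

lemma radial_Mellin_zero_imp_AE_0:
  assumes m: "g \<in> borel_measurable disk_measure" and K: "\<And>z. z \<in> unit_disk \<Longrightarrow> cmod (g z) \<le> K"
    and rad: "radial g" and zero: "\<And>x. 0 < x \<Longrightarrow> Mellin g (of_real x) = 0"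
  shows "AE z in disk_measure. g z = 0"
proof -
  note [measurable] = m measurable_disk_ident
  \<comment> \<open>The factor \<open>\<bar>z\<bar>\<^sup>2\<close> avoids the moment of exponent \<open>0\<close>, about which \<open>zero\<close> says nothing.\<close>
  define h where "h = (\<lambda>z. g z * (z * cnj z))"
  have hm [measurable]: "h \<in> borel_measurable disk_measure" unfolding h_def by measurable
  have "moment_free h"
    unfolding moment_free_def
  proof (intro conjI allI)
    have "cmod (h z) \<le> K * (1 * 1)" if z: "z \<in> unit_disk" for z
      unfolding h_def norm_mult complex_mod_cnj using K[OF z] z order_trans[OF norm_ge_zero K[OF z]]
      by (intro mult_mono) auto
    thus "\<exists>K. \<forall>z\<in>unit_disk. cmod (h z) \<le> K" by blast
    fix a b
    show "(LINT z|disk_measure. h z * (z ^ a * cnj z ^ b)) = 0"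
    proof (cases "a = b")
      case True
      have "h z * (z ^ a * cnj z ^ b) = g z * radial_power (of_nat (2 * (a + 1))) z" for z
      proof -
        have "h z * (z ^ a * cnj z ^ b) = g z * (z * cnj z) ^ (a + 1)"
          using True by (simp add: h_def power_mult_distrib mult_ac)
        also have "\<dots> = g z * of_real (cmod z ^ (2 * (a + 1)))"
          by (simp only: complex_norm_square[symmetric] of_real_power power_mult)
        finally show ?thesis by (subst radial_power_of_nat) auto
      qed
      thus ?thesis using zero[of "real (2 * (a + 1))"] by (simp add: Mellin_def)
    next
      case False
      show ?thesis
      proof (rule integral_disk_weight_eq_0)
        show "int a - int b \<noteq> 0" using False by simp
        fix w z :: complex assume wz: "cmod w = 1" "z \<in> unit_disk" "z \<noteq> 0"
        have "g (w * z) = g z" using rad[unfolded radial_def, rule_format, of "w * z" z] wz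
          by (simp add: norm_mult)
        hence "h (w * z) * ((w * z) ^ a * cnj (w * z) ^ b) =
            (w * cnj w) * (cnj w ^ b * w ^ a) * (h z * (z ^ a * cnj z ^ b))"
          by (simp only: h_def complex_cnj_mult power_mult_distrib mult_ac)
        moreover have "w * cnj w = 1"
          using wz by (simp add: complex_norm_square[symmetric])
        moreover have "w powi (int a - int b) = cnj w ^ b * w ^ a"
          using cnj_unit_powi[of w "int b" "int a"] wz by simp
        ultimately show "h (w * z) * ((w * z) ^ a * cnj (w * z) ^ b) =
            w powi (int a - int b) * (h z * (z ^ a * cnj z ^ b))"
          by simp
      qed measurable
    qed
  qed (rule hm)
  from moment_free_AE_0[OF this] AE_disk_measure_nonzero show ?thesis
    by eventually_elim (simp add: h_def)
qed

text \<open>The hypotheses \<open>p_nonzero\<close> and \<open>psi_nonzero\<close> exclude genuine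
  exceptions: for \<open>p = 0\<close> both operators are diagonal in the monomials and always
  commute, and the zero operator commutes with everything. Equality is almost everywhere because the
  operators do not see null sets.\<close>

theorem theorem5:
  fixes \<phi> \<psi> :: "complex \<Rightarrow> complex" and p :: int
  assumes "\<phi> \<in> borel_measurable (lebesgue_on unit_disk)" "bounded (\<phi> ` unit_disk)" "radial \<phi>"
    and "\<psi> \<in> borel_measurable (lebesgue_on unit_disk)" "bounded (\<psi> ` unit_disk)" "radial \<psi>"
    and p_nonzero: "p \<noteq> 0"
    and psi_nonzero: "\<not> (AE z in disk_measure. \<psi> z = 0)"
    and commute: "\<forall>u\<in>harmonic_Bergman.
       Toeplitz (quasihomogeneous p \<phi>) (Toeplitz (quasihomogeneous p \<psi>) u) =
       Toeplitz (quasihomogeneous p \<psi>) (Toeplitz (quasihomogeneous p \<phi>) u)"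
  shows "\<exists>c::complex. AE z in disk_measure. \<phi> z = c * \<psi> z"
proof -
  have m: "\<phi> \<in> borel_measurable disk_measure" "\<psi> \<in> borel_measurable disk_measure"
    using assms(1,4) by (simp_all add: measurable_disk_measure_eq)
  obtain K where K: "\<And>z. z \<in> unit_disk \<Longrightarrow> cmod (\<phi> z) \<le> K"
    using assms(2) unfolding bounded_iff by blast
  obtain L where L: "\<And>z. z \<in> unit_disk \<Longrightarrow> cmod (\<psi> z) \<le> L"
    using assms(5) unfolding bounded_iff by blast
  have T\<phi>: "Toeplitz (quasihomogeneous p \<phi>) (\<lambda>z. c * harmonic_monomial n z) =
    (\<lambda>z. c * (Mellin \<phi> (of_int (\<bar>n\<bar> + \<bar>n + p\<bar>)) / monomial_norm2 (n + p)) * harmonic_monomial (n + p) z)"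
    if "0 < \<bar>n\<bar> + \<bar>n + p\<bar>" for n c
    by (rule Toeplitz_harmonic_monomial[OF m(1) K assms(3) that])
  have T\<psi>: "Toeplitz (quasihomogeneous p \<psi>) (\<lambda>z. c * harmonic_monomial n z) =
    (\<lambda>z. c * (Mellin \<psi> (of_int (\<bar>n\<bar> + \<bar>n + p\<bar>)) / monomial_norm2 (n + p)) * harmonic_monomial (n + p) z)"
    if "0 < \<bar>n\<bar> + \<bar>n + p\<bar>" for n c
    by (rule Toeplitz_harmonic_monomial[OF m(2) L assms(6) that])
  have comm: "Mellin \<phi> (of_int (\<bar>n\<bar> + \<bar>n + p\<bar>)) * Mellin \<psi> (of_int (\<bar>n + p\<bar> + \<bar>n + p + p\<bar>)) =
      Mellin \<phi> (of_int (\<bar>n + p\<bar> + \<bar>n + p + p\<bar>)) * Mellin \<psi> (of_int (\<bar>n\<bar> + \<bar>n + p\<bar>))" for n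
  proof -
    \<comment> \<open>As \<open>p\<close> is nonzero, two consecutive indices of the progression
      cannot both be 0.\<close>
    have pos: "0 < \<bar>n\<bar> + \<bar>n + p\<bar>" "0 < \<bar>n + p\<bar> + \<bar>n + p + p\<bar>" using p_nonzero by linarith+
    have "(\<lambda>z. 1 * harmonic_monomial n z) \<in> harmonic_Bergman"
      by (rule harmonic_monomial_in_harmonic_Bergman)
    \<comment> \<open>Both compositions give multiples of the same monomial. Evaluating at 1/2,
      where it does not vanish, lets the common factors cancel.\<close>
    from bspec[OF commute this]
    have "1 * (Mellin \<psi> (of_int (\<bar>n\<bar> + \<bar>n + p\<bar>)) / monomial_norm2 (n + p))
          * (Mellin \<phi> (of_int (\<bar>n + p\<bar> + \<bar>n + p + p\<bar>)) / monomial_norm2 (n + p + p))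
          * harmonic_monomial (n + p + p) (1/2) =
        1 * (Mellin \<phi> (of_int (\<bar>n\<bar> + \<bar>n + p\<bar>)) / monomial_norm2 (n + p))
          * (Mellin \<psi> (of_int (\<bar>n + p\<bar> + \<bar>n + p + p\<bar>)) / monomial_norm2 (n + p + p))
          * harmonic_monomial (n + p + p) (1/2)"
      unfolding T\<phi>[OF pos(1)] T\<psi>[OF pos(1)] T\<phi>[OF pos(2)] T\<psi>[OF pos(2)] by (rule fun_cong)
    moreover have "harmonic_monomial (n + p + p) (1/2) \<noteq> 0"
      using cmod_harmonic_monomial[of "1/2" "n + p + p"] by auto
    ultimately show ?thesis
      using monomial_norm2_nonzero by (simp add: mult_ac)
  qed
  define q where "q = real_of_int \<bar>p\<bar>"
  have q: "0 < q" using p_nonzero by (simp add: q_def)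
  have "\<exists>c. \<forall>x>0. Mellin \<phi> (of_real x) = c * Mellin \<psi> (of_real x)"
  proof (rule right_half_plane_proportional[where a = q and h = 2 and d = "2 * q"
        and MA = "K * measure disk_measure unit_disk" and MB = "L * measure disk_measure unit_disk"])
    show "Mellin \<phi> (of_real (q + 2 * of_nat j)) * Mellin \<psi> (of_real (q + 2 * of_nat j + 2 * q)) =
        Mellin \<phi> (of_real (q + 2 * of_nat j + 2 * q)) * Mellin \<psi> (of_real (q + 2 * of_nat j))" for j
    proof -
      \<comment> \<open>With the sign of \<open>p\<close>, the absolute values add up without
        cancellation: the two exponents are \<open>\<bar>p\<bar> + 2 * j\<close> and the same number
        increased by \<open>2 * \<bar>p\<bar>\<close>.\<close>
      define n where "n = sgn p * int j"
      have "\<bar>n\<bar> + \<bar>n + p\<bar> = \<bar>p\<bar> + 2 * int j" "\<bar>n + p\<bar> + \<bar>n + p + p\<bar> = \<bar>p\<bar> + 2 * int j + 2 * \<bar>p\<bar>"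
        using p_nonzero by (auto simp: n_def sgn_if)
      moreover have "complex_of_int (\<bar>p\<bar> + 2 * int j) = of_real (q + 2 * of_nat j)"
        "complex_of_int (\<bar>p\<bar> + 2 * int j + 2 * \<bar>p\<bar>) = of_real (q + 2 * of_nat j + 2 * q)"
        by (simp_all del: of_int_abs add: q_def)
      ultimately show ?thesis using comm[of n] by simp
    qed
    show "\<exists>x>0. Mellin \<psi> (of_real x) \<noteq> 0"
      using radial_Mellin_zero_imp_AE_0[OF m(2) L assms(6)] psi_nonzero by blast
  qed (use q holomorphic_Mellin[OF m(1) K] holomorphic_Mellin[OF m(2) L]
      cmod_Mellin_le[OF m(1) K] cmod_Mellin_le[OF m(2) L] in auto)
  then obtain c where c: "\<And>x. 0 < x \<Longrightarrow> Mellin \<phi> (of_real x) = c * Mellin \<psi> (of_real x)"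
    by blast
  \<comment> \<open>By linearity the Mellin transform of \<open>g\<close> vanishes on the positive
    reals, so \<open>g\<close> is determined to be 0 almost everywhere.\<close>
  define g where "g = (\<lambda>z. \<phi> z - c * \<psi> z)"
  have "AE z in disk_measure. g z = 0"
  proof (rule radial_Mellin_zero_imp_AE_0)
    show "g \<in> borel_measurable disk_measure" unfolding g_def using m by measurable
    show "cmod (g z) \<le> K + cmod c * L" if "z \<in> unit_disk" for z
      unfolding g_def using K[OF that] mult_left_mono[OF L[OF that], of "cmod c"]
      by (intro order_trans[OF norm_triangle_ineq4]) (auto simp: norm_mult)
    show "radial g" using assms(3,6) unfolding radial_def g_def by metis
    fix x :: real assume x: "0 < x"
    have i: "integrable disk_measure (\<lambda>z. f z * radial_power (of_real x) z)"
      if "f \<in> borel_measurable disk_measure" "\<And>z. z \<in> unit_disk \<Longrightarrow> cmod (f z) \<le> B" for f B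
    proof (rule disk_integrable_bounded[of _ "B * 1"])
      show "(\<lambda>z. f z * radial_power (of_real x) z) \<in> borel_measurable disk_measure"
        using that(1) measurable_radial_power by measurable
      show "cmod (f z * radial_power (of_real x) z) \<le> B * 1" if z: "z \<in> unit_disk" for z
        unfolding norm_mult using x z \<open>\<And>z. z \<in> unit_disk \<Longrightarrow> cmod (f z) \<le> B\<close>[OF z]
          order_trans[OF norm_ge_zero \<open>\<And>z. z \<in> unit_disk \<Longrightarrow> cmod (f z) \<le> B\<close>[OF z]]
        by (intro mult_mono cmod_radial_power_le_1) auto
    qed
    have "Mellin g (of_real x) =
        (LINT z|disk_measure. \<phi> z * radial_power (of_real x) z - c * (\<psi> z * radial_power (of_real x) z))"
      by (simp add: Mellin_def g_def algebra_simps)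
    also have "\<dots> = Mellin \<phi> (of_real x) - c * Mellin \<psi> (of_real x)"
      using i[OF m(1) K] i[OF m(2) L] by (simp add: Mellin_def)
    finally show "Mellin g (of_real x) = 0" by (simp add: c[OF x])
  qed
  hence "AE z in disk_measure. \<phi> z = c * \<psi> z" by (simp add: g_def)
  thus ?thesis by blast
qed

end
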